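(* Let $G$ be a bipartite graph with edge ideal $I=I(G)$, and let $\mathcal{K}\subset S$ be the ideal of defining equations of the Rees algebra $\mathcal{R}(I)$. The universal Gröbner basis $\mathcal{U}$ of $\mathcal{K}$ is given by \begin{align*} \mathcal{U} &= \{ T_w \mid w \text{ is an even cycle in } G\} \\ &\cup \{ v_0T_{w^+}-v_aT_{w^-} \mid w=(v_0,\ldots,v_a) \text{ is an even path in } G\}\\ &\cup \{u_0u_aT_{(w_1,w_2)^+}- v_0v_bT_{(w_1,w_2)^-} \mid w_1=(u_0,\ldots,u_a) \text{ and } w_2=(v_0,\ldots,v_b) \text{ are disjoint odd paths in } G\}. \end{align*}
   Context: Let $G$ be a bipartite graph with bipartition $X=\{x_1,\ldots,x_n\}$, $Y=\{y_1,\ldots,y_m\}$ of its vertex set, $\mathbb{K}$ a field, and $R=\mathbb{K}[x_1,\ldots,x_n,y_1,\ldots,y_m]$ (vertices are identified with variables). The edge ideal $I=I(G)=(f_1,\ldots,f_q)\subset R$ is generated by the monomials $x_iy_j$ with $x_i$ adjacent to $y_j$; $f_1,\ldots,f_q$ are these monomials (one per edge). The Rees algebra is $\mathcal{R}(I)=\bigoplus_{i\ge 0} I^it^i\subset R[t]$. Let $S=R[T_1,\ldots,T_q]$ and let $\psi:S\to\mathcal{R}(I)$ be the surjective $\mathbb{K}$-algebra map with $\psi(x_i)=x_i$, $\psi(y_i)=y_i$, $\psi(T_i)=f_it$. The ideal of defining equations is $\mathcal{K}=\operatorname{Ker}(\psi)$. The universal Gröbner basis of $\mathcal{K}$ is the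 union of all reduced Gröbner bases of $\mathcal{K}$ with respect to $<$, as $<$ runs over all monomial orders on $S$. A cycle or path is even (odd) if its number of edges is even (odd); two paths are disjoint if they have no common vertex. For a walk $w=(v_0,\ldots,v_a)$ in $G$, let $T_{i_j}$ be the variable corresponding to the edge $\{v_{j-1},v_j\}$ ($1\le j\le a$), and set $T_{w^+}=\prod_{j \text{ even}}T_{i_j}$ and $T_{w^-}=\prod_{j\text{ odd}}T_{i_j}$ (if $a=1$, then $T_{w^+}=1$). For an even cycle $w=(v_0,\ldots,v_a=v_0)$, $T_w=T_{w^+}-T_{w^-}$. For two disjoint odd paths $w_1,w_2$, $T_{(w_1,w_2)^+}=T_{w_1^+}T_{w_2^-}$ and $T_{(w_1,w_2)^-}=T_{w_1^-}T_{w_2^+}$. *)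

theory Defs
  imports
    "HOL-Library.Poly_Mapping"
    "HOL-Computational_Algebra.Polynomial"
    "HOL-Algebra.Ideal_Product"
begin

section \<open>Polynomial rings in several variables\<close>

text \<open>
  A monomial is its exponent vector, so multiplication of monomials is addition in
  \<^typ>\<open>'v \<Rightarrow>\<^sub>0 nat\<close>, and the multiplication of polynomials is the convolution product
  supplied by \<^theory>\<open>HOL-Library.Poly_Mapping\<close>.
\<close>

type_synonym 'v monomial = "'v \<Rightarrow>\<^sub>0 nat"
type_synonym ('v, 'k) mpoly = "'v monomial \<Rightarrow>\<^sub>0 'k"

definition Var :: "'v \<Rightarrow> ('v, 'k::field) mpoly" where
  "Var v = Poly_Mapping.single (Poly_Mapping.single v 1) 1"

definition Const :: "'k \<Rightarrow> ('v, 'k::field) mpoly" where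
  "Const c = Poly_Mapping.single 0 c"

definition monomials :: "'v set \<Rightarrow> 'v monomial set" where
  "monomials V = {m. Poly_Mapping.keys m \<subseteq> V}"

definition ring_on :: "'a set \<Rightarrow> 'a::comm_ring_1 ring" where
  "ring_on A = \<lparr>carrier = A, mult = (*), one = 1, zero = 0, add = (+)\<rparr>"

definition poly_ring :: "'v set \<Rightarrow> ('v, 'k::field) mpoly ring" where
  "poly_ring V = ring_on {p. Poly_Mapping.keys p \<subseteq> monomials V}"


section \<open>Groebner bases\<close>

text \<open>A pair \<open>(m, m')\<close> in the relation means that \<open>m\<close> is at most \<open>m'\<close>.\<close>

definition monomial_order :: "'v set \<Rightarrow> 'v monomial rel \<Rightarrow> bool" where
  "monomial_order V r \<longleftrightarrow>
     linear_order_on (monomials V) r \<and>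
     (\<forall>m \<in> monomials V. (0, m) \<in> r) \<and>
     (\<forall>m m'. \<forall>u \<in> monomials V. (m, m') \<in> r \<longrightarrow> (m + u, m' + u) \<in> r)"

text \<open>Leading monomial and leading coefficient are meaningful for nonzero polynomials only.\<close>

definition lead_mon :: "'v monomial rel \<Rightarrow> ('v, 'k::field) mpoly \<Rightarrow> 'v monomial" where
  "lead_mon r p = (THE m. m \<in> Poly_Mapping.keys p \<and> (\<forall>m' \<in> Poly_Mapping.keys p. (m', m) \<in> r))"

definition lead_coef :: "'v monomial rel \<Rightarrow> ('v, 'k::field) mpoly \<Rightarrow> 'k" where
  "lead_coef r p = Poly_Mapping.lookup p (lead_mon r p)"

definition initial_ideal ::
  "'v set \<Rightarrow> 'v monomial rel \<Rightarrow> ('v, 'k::field) mpoly set \<Rightarrow> ('v, 'k) mpoly set" where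
  "initial_ideal V r F =
     Idl\<^bsub>poly_ring V\<^esub> {Poly_Mapping.single (lead_mon r f) 1 | f. f \<in> F \<and> f \<noteq> 0}"

definition groebner_basis ::
  "'v set \<Rightarrow> 'v monomial rel \<Rightarrow> ('v, 'k::field) mpoly set \<Rightarrow> ('v, 'k) mpoly set \<Rightarrow> bool" where
  "groebner_basis V r J B \<longleftrightarrow>
     finite B \<and> B \<subseteq> J \<and> 0 \<notin> B \<and> initial_ideal V r B = initial_ideal V r J"

definition reduced_groebner_basis ::
  "'v set \<Rightarrow> 'v monomial rel \<Rightarrow> ('v, 'k::field) mpoly set \<Rightarrow> ('v, 'k) mpoly set \<Rightarrow> bool" where
  "reduced_groebner_basis V r J B \<longleftrightarrow>
     groebner_basis V r J B \<and>
     (\<forall>g \<in> B. lead_coef r g = 1) \<and>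
     (\<forall>g \<in> B. \<forall>h \<in> B. g \<noteq> h \<longrightarrow>
        (\<forall>m \<in> Poly_Mapping.keys h. \<not> (\<exists>u. m = lead_mon r g + u)))"

definition universal_groebner_basis ::
  "'v set \<Rightarrow> ('v, 'k::field) mpoly set \<Rightarrow> ('v, 'k) mpoly set" where
  "universal_groebner_basis V J =
     \<Union>{B. \<exists>r. monomial_order V r \<and> reduced_groebner_basis V r J B}"


section \<open>Bipartite graphs, paths and cycles\<close>

definition bipartite_graph :: "'v set \<Rightarrow> 'v set \<Rightarrow> 'v set set \<Rightarrow> bool" where
  "bipartite_graph X Y E \<longleftrightarrow>
     finite X \<and> finite Y \<and> X \<inter> Y = {} \<and> E \<subseteq> {{x, y} | x y. x \<in> X \<and> y \<in> Y}"

text \<open>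
  A walk \<open>(v\<^sub>0, \<dots>, v\<^sub>a)\<close> is the list of its \<open>a + 1\<close> vertices.  Paths have at least one edge.
  For the one-vertex list, an even path in the numerical sense, the binomial below is \<open>0\<close>.
\<close>

definition walk_length :: "'v list \<Rightarrow> nat" where
  "walk_length w = length w - 1"

definition is_path :: "'v set set \<Rightarrow> 'v list \<Rightarrow> bool" where
  "is_path E w \<longleftrightarrow>
     walk_length w \<ge> 1 \<and> successively (\<lambda>u v. {u, v} \<in> E) w \<and> distinct w"

definition is_cycle :: "'v set set \<Rightarrow> 'v list \<Rightarrow> bool" where
  "is_cycle E w \<longleftrightarrow>
     walk_length w \<ge> 3 \<and> successively (\<lambda>u v. {u, v} \<in> E) w \<and>
     hd w = last w \<and> distinct (tl w)"

definition even_path :: "'v set set \<Rightarrow> 'v list \<Rightarrow> bool" where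
  "even_path E w \<longleftrightarrow> is_path E w \<and> even (walk_length w)"

definition odd_path :: "'v set set \<Rightarrow> 'v list \<Rightarrow> bool" where
  "odd_path E w \<longleftrightarrow> is_path E w \<and> odd (walk_length w)"

definition even_cycle :: "'v set set \<Rightarrow> 'v list \<Rightarrow> bool" where
  "even_cycle E w \<longleftrightarrow> is_cycle E w \<and> even (walk_length w)"

definition disjoint_paths :: "'v list \<Rightarrow> 'v list \<Rightarrow> bool" where
  "disjoint_paths w1 w2 \<longleftrightarrow> set w1 \<inter> set w2 = {}"


section \<open>The Rees algebra of the edge ideal and its defining equations\<close>

text \<open>
  The variables of \<open>S\<close> are the vertices and, instead of \<open>T\<^sub>1, \<dots>, T\<^sub>q\<close>, one variable per edge,
  indexed by the edge itself.
\<close>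

datatype 'v rees_var = Vert 'v | Edge "'v set"

definition rees_vars :: "'v set \<Rightarrow> 'v set \<Rightarrow> 'v set set \<Rightarrow> 'v rees_var set" where
  "rees_vars X Y E = Vert ` (X \<union> Y) \<union> Edge ` E"

definition edge_monomial :: "'v set \<Rightarrow> ('v, 'k::field) mpoly" where
  "edge_monomial e = (\<Prod>v\<in>e. Var v)"

definition edge_ideal :: "'v set \<Rightarrow> 'v set \<Rightarrow> 'v set set \<Rightarrow> ('v, 'k::field) mpoly set" where
  "edge_ideal X Y E = Idl\<^bsub>poly_ring (X \<union> Y)\<^esub> (edge_monomial ` E)"

text \<open>The unit of the multiplicative structure \<^term>\<open>ideals_set R\<close> is \<open>R\<close>, so \<open>I\<^sup>0 = R\<close>.\<close>

definition rees_algebra ::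
  "('v, 'k::field) mpoly ring \<Rightarrow> ('v, 'k) mpoly set \<Rightarrow> ('v, 'k) mpoly poly ring" where
  "rees_algebra R I = ring_on {p. \<forall>i. coeff p i \<in> I [^]\<^bsub>ideals_set R\<^esub> i}"

primrec rees_var_image :: "'v rees_var \<Rightarrow> ('v, 'k::field) mpoly poly" where
  "rees_var_image (Vert v) = [:Var v:]"
| "rees_var_image (Edge e) = monom (edge_monomial e) 1"

text \<open>The \<open>K\<close>-algebra map given by substituting \<^const>\<open>rees_var_image\<close> for the variables.\<close>

definition rees_map :: "('v rees_var, 'k::field) mpoly \<Rightarrow> ('v, 'k) mpoly poly" where
  "rees_map p =
     (\<Sum>m \<in> Poly_Mapping.keys p.
        [:Const (Poly_Mapping.lookup p m):] *
        (\<Prod>z \<in> Poly_Mapping.keys m. rees_var_image z ^ Poly_Mapping.lookup m z))"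

definition defining_ideal ::
  "'v set \<Rightarrow> 'v set \<Rightarrow> 'v set set \<Rightarrow> ('v rees_var, 'k::field) mpoly set" where
  "defining_ideal X Y E =
     a_kernel (poly_ring (rees_vars X Y E))
       (rees_algebra (poly_ring (X \<union> Y)) (edge_ideal X Y E)) rees_map"


section \<open>The binomials attached to cycles and paths\<close>

definition vert :: "'v \<Rightarrow> ('v rees_var, 'k::field) mpoly" where
  "vert v = Var (Vert v)"

definition T_plus :: "'v list \<Rightarrow> ('v rees_var, 'k::field) mpoly" where
  "T_plus w = (\<Prod>j \<in> {j \<in> {1..walk_length w}. even j}. Var (Edge {w ! (j - 1), w ! j}))"

definition T_minus :: "'v list \<Rightarrow> ('v rees_var, 'k::field) mpoly" where
  "T_minus w = (\<Prod>j \<in> {j \<in> {1..walk_length w}. odd j}. Var (Edge {w ! (j - 1), w ! j}))"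

definition cycle_binomial :: "'v list \<Rightarrow> ('v rees_var, 'k::field) mpoly" where
  "cycle_binomial w = T_plus w - T_minus w"

definition path_binomial :: "'v list \<Rightarrow> ('v rees_var, 'k::field) mpoly" where
  "path_binomial w = vert (hd w) * T_plus w - vert (last w) * T_minus w"

definition T_pair_plus :: "'v list \<Rightarrow> 'v list \<Rightarrow> ('v rees_var, 'k::field) mpoly" where
  "T_pair_plus w1 w2 = T_plus w1 * T_minus w2"

definition T_pair_minus :: "'v list \<Rightarrow> 'v list \<Rightarrow> ('v rees_var, 'k::field) mpoly" where
  "T_pair_minus w1 w2 = T_minus w1 * T_plus w2"

definition path_pair_binomial :: "'v list \<Rightarrow> 'v list \<Rightarrow> ('v rees_var, 'k::field) mpoly" where
  "path_pair_binomial w1 w2 =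
     vert (hd w1) * vert (last w1) * T_pair_plus w1 w2
     - vert (hd w2) * vert (last w2) * T_pair_minus w1 w2"

end

theory Submission
  imports Defs
begin

text \<open>
  Add one vertex to each side of \<open>G\<close> and join it to all vertices of the other side. In this larger
  bipartite graph read a variable \<open>T\<close> as the edge of \<open>G\<close> that indexes it, and a variable \<open>x\<close> or \<open>y\<close>
  as the edge from this vertex to the new vertex opposite to it. A monomial of \<open>S\<close> becomes a
  multiplicity function on the edges, and two monomials have the same image in the Rees algebra if
  and only if these functions have the same sum at every vertex (\<open>same_degree_iff\<close>). So the
  defining ideal is the toric ideal of a bipartite graph.

  The difference of two monomials with equal image is then a circulation: orient edges with
  positive values from left to right and those with negative values from right to left. Two
  properties of circulations of a bipartite graph matter. Every nonzero circulation contains a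
  directed cycle, whose edges have alternating signs (\<open>exists_alt_cycle\<close>), and a nonzero circulation
  on the edges of a single cycle alternates in sign along it (\<open>alt_cycle_rigid\<close>).

  These properties determine the universal Groebner basis. Fix a monomial order and call a monomial
  standard if it is least among the monomials with its image. If \<open>m\<close> is a minimal generator of the
  initial ideal and \<open>m'\<close> is the standard monomial with the same image, then some cycle has one side dividing \<open>m\<close> and the other side dividing \<open>m'\<close>; the second side is standard as a
  divisor of \<open>m'\<close>, and the first one is all of \<open>m\<close> by minimality. Therefore elements of reduced
  Groebner bases are binomials of cycles (\<open>reduced_groebner_basis_circuit\<close>). Conversely, a
  lexicographic order in which the variables of a given cycle come last makes every monomial in these
  variables smaller than all monomials with another variable, and among the former rigidity leaves
  no competitor to the two sides of the cycle; so its binomial is in the reduced Groebner basis for this order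
  (\<open>circuit_elimination_order\<close>).

  It remains to list the cycles of the larger graph by the new vertices they visit
  (\<open>circuit_binomials_eq\<close>). A cycle that visits none of them is a cycle of \<open>G\<close>; one that visits
  exactly one is an even path of \<open>G\<close>, closed up through the new vertex; and one that visits both
  consists of two disjoint odd paths.
\<close>

section \<open>Divisibility of monomials\<close>

definition mon_dvd :: "'z monomial \<Rightarrow> 'z monomial \<Rightarrow> bool" where
  "mon_dvd p m \<longleftrightarrow> (\<exists>u. m = p + u)"

lemma mon_dvd_iff_lookup_le:
  "mon_dvd p m \<longleftrightarrow> (\<forall>z. Poly_Mapping.lookup p z \<le> Poly_Mapping.lookup m z)"
proof
  assume "\<forall>z. Poly_Mapping.lookup p z \<le> Poly_Mapping.lookup m z"
  then have "m = p + (m - p)"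
    by (intro poly_mapping_eqI) (simp add: lookup_add lookup_minus)
  then show "mon_dvd p m"
    unfolding mon_dvd_def by blast
qed (auto simp: mon_dvd_def lookup_add)

lemma mon_dvd_refl: "mon_dvd m m"
  by (simp add: mon_dvd_iff_lookup_le)

lemma mon_dvd_trans: "mon_dvd a b \<Longrightarrow> mon_dvd b c \<Longrightarrow> mon_dvd a c"
  unfolding mon_dvd_iff_lookup_le by (meson order_trans)

lemma mon_dvd_antisym: "mon_dvd a b \<Longrightarrow> mon_dvd b a \<Longrightarrow> a = b"
  unfolding mon_dvd_iff_lookup_le by (intro poly_mapping_eqI) (meson order_antisym)

lemma keys_mono_mon_dvd: "mon_dvd a b \<Longrightarrow> Poly_Mapping.keys a \<subseteq> Poly_Mapping.keys b"
  unfolding mon_dvd_iff_lookup_le in_keys_iff subset_iff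
  by (metis le_zero_eq)

lemma monomials_mon_dvd: "m \<in> monomials V \<Longrightarrow> mon_dvd p m \<Longrightarrow> p \<in> monomials V"
  using keys_mono_mon_dvd by (fastforce simp: monomials_def)

lemma monomials_add: "a \<in> monomials V \<Longrightarrow> b \<in> monomials V \<Longrightarrow> a + b \<in> monomials V"
  using Poly_Mapping.keys_add[of a b] by (auto simp: monomials_def)

lemma mon_dvd_minimal_divisor:
  fixes m :: "'z monomial"
  assumes "P m"
  shows "\<exists>p. P p \<and> mon_dvd p m \<and> (\<forall>q. P q \<longrightarrow> mon_dvd q p \<longrightarrow> q = p)"
proof -
  \<comment> \<open>A proper divisor has smaller total degree, and its exponents all live on the keys of \<open>m\<close>.\<close>
  define total :: "'z monomial \<Rightarrow> nat"
    where "total = (\<lambda>q. \<Sum>z\<in>Poly_Mapping.keys m. Poly_Mapping.lookup q z)"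
  obtain p where p: "P p" "mon_dvd p m"
    and min: "\<And>q. P q \<Longrightarrow> mon_dvd q m \<Longrightarrow> total p \<le> total q"
    using assms mon_dvd_refl
      ex_has_least_nat[of "\<lambda>q. P q \<and> mon_dvd q m" m total] by blast
  have "q = p" if q: "P q" "mon_dvd q p" for q
  proof (rule ccontr)
    assume "q \<noteq> p"
    then obtain z where z: "Poly_Mapping.lookup q z < Poly_Mapping.lookup p z"
      using q(2) unfolding mon_dvd_iff_lookup_le by (metis le_neq_implies_less poly_mapping_eqI)
    then have "z \<in> Poly_Mapping.keys p"
      by (simp add: in_keys_iff)
    then have "z \<in> Poly_Mapping.keys m"
      using keys_mono_mon_dvd[OF p(2)] by blast
    then have "total q < total p"
      unfolding total_def using q(2) z
      by (intro sum_strict_mono_ex1) (auto simp: mon_dvd_iff_lookup_le)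
    then show False
      using min[OF q(1) mon_dvd_trans[OF q(2) p(2)]] by simp
  qed
  then show ?thesis using p by blast
qed


section \<open>Monomial ideals\<close>

lemma ring_poly_ring: "ring (poly_ring V :: ('z, 'k::field) mpoly ring)"
proof -
  let ?C = "{p :: ('z, 'k) mpoly. Poly_Mapping.keys p \<subseteq> monomials V}"
  have add: "p + q \<in> ?C" if "p \<in> ?C" "q \<in> ?C" for p q
    using that Poly_Mapping.keys_add[of p q] by auto
  have mult: "p * q \<in> ?C" if "p \<in> ?C" "q \<in> ?C" for p q
    using that keys_mult[of p q] monomials_add by fastforce
  have neg: "- p \<in> ?C" if "p \<in> ?C" for p
    using that by (auto simp: in_keys_iff)
  have units: "0 \<in> ?C" "1 \<in> ?C"
    by (auto simp: monomials_def)
  show ?thesis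
  proof (rule ringI)
    show "abelian_group (poly_ring V :: ('z, 'k) mpoly ring)"
    proof (rule abelian_groupI, goal_cases)
      case (6 x)
      then show ?case
        using neg[of x] by (intro bexI[of _ "- x"]) (auto simp: poly_ring_def ring_on_def)
    qed (use add units in \<open>auto simp: poly_ring_def ring_on_def add.commute add.assoc\<close>)
    show "Group.monoid (poly_ring V :: ('z, 'k) mpoly ring)"
      by (rule monoidI) (use mult units in \<open>auto simp: poly_ring_def ring_on_def mult.assoc\<close>)
  qed (auto simp: poly_ring_def ring_on_def algebra_simps)
qed

text \<open>The polynomials all of whose monomials are divisible by a member of \<open>A\<close> form an ideal; since it
  contains the generators, a monomial of the generated ideal is such a multiple.\<close>

lemma single_in_monomial_ideal_iff:
  fixes V :: "'z set"
  assumes A: "A \<subseteq> monomials V" and m: "m \<in> monomials V"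
  shows "Poly_Mapping.single m 1
           \<in> Idl\<^bsub>poly_ring V\<^esub> {Poly_Mapping.single a (1::'k::field) | a. a \<in> A}
         \<longleftrightarrow> (\<exists>a\<in>A. mon_dvd a m)" (is "_ \<in> Idl\<^bsub>?R\<^esub> ?G \<longleftrightarrow> _")
proof -
  interpret ring ?R by (rule ring_poly_ring)
  have G: "?G \<subseteq> carrier ?R"
    using A by (auto simp: poly_ring_def ring_on_def)
  let ?I = "{p \<in> carrier ?R. \<forall>m\<in>Poly_Mapping.keys p. \<exists>a\<in>A. mon_dvd a m}"
  have mult: "x * p \<in> ?I" if "p \<in> ?I" "x \<in> carrier ?R" for p x
  proof -
    have "\<exists>a\<in>A. mon_dvd a m'" if "m' \<in> Poly_Mapping.keys (x * p)" for m'
    proof -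
      obtain b c where "m' = c + b" "b \<in> Poly_Mapping.keys x" "c \<in> Poly_Mapping.keys p"
        using \<open>m' \<in> _\<close> keys_mult[of x p] by (auto simp: add.commute)
      then show ?thesis
        using \<open>p \<in> ?I\<close> mon_dvd_trans by (fastforce simp: mon_dvd_def)
    qed
    moreover have "x * p \<in> carrier ?R"
      using m_closed[of x p] that by (simp add: poly_ring_def ring_on_def)
    ultimately show ?thesis by blast
  qed
  have ideal: "ideal ?I ?R"
  proof (rule idealI)
    show "subgroup ?I (add_monoid ?R)"
    proof (rule add.subgroupI)
      show "?I \<subseteq> carrier ?R"
        by auto
    next
      show "?I \<noteq> {}"
        by (auto simp: poly_ring_def ring_on_def intro!: exI[of _ 0])
    next
      fix p assume p: "p \<in> ?I"
      have "\<ominus>\<^bsub>?R\<^esub> p = - p"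
      proof (rule minus_equality)
        show "- p \<oplus>\<^bsub>?R\<^esub> p = \<zero>\<^bsub>?R\<^esub>" "p \<in> carrier ?R" "- p \<in> carrier ?R"
          using p by (auto simp: poly_ring_def ring_on_def)
      qed
      then show "\<ominus>\<^bsub>?R\<^esub> p \<in> ?I"
        using p by (simp add: poly_ring_def ring_on_def)
    next
      fix p q assume "p \<in> ?I" "q \<in> ?I"
      then show "p \<oplus>\<^bsub>?R\<^esub> q \<in> ?I"
        using Poly_Mapping.keys_add[of p q] by (auto simp: poly_ring_def ring_on_def)
    qed
    show "x \<otimes>\<^bsub>?R\<^esub> p \<in> ?I" "p \<otimes>\<^bsub>?R\<^esub> x \<in> ?I" if "p \<in> ?I" "x \<in> carrier ?R" for p x
      using mult[OF that] by (simp_all add: poly_ring_def ring_on_def mult.commute)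
  qed (rule ring_poly_ring)
  have "?G \<subseteq> ?I"
    using G by (auto intro: mon_dvd_refl split: if_splits)
  then have sub: "Idl\<^bsub>?R\<^esub> ?G \<subseteq> ?I"
    by (rule genideal_minimal[OF ideal])
  show ?thesis
  proof
    assume "Poly_Mapping.single m 1 \<in> Idl\<^bsub>?R\<^esub> ?G"
    then show "\<exists>a\<in>A. mon_dvd a m"
      using sub by auto
  next
    assume "\<exists>a\<in>A. mon_dvd a m"
    then obtain a u where a: "a \<in> A" and u: "m = a + u"
      by (auto simp: mon_dvd_def)
    have "u \<in> monomials V"
      using monomials_mon_dvd[OF m, of u] u by (auto simp: mon_dvd_def add.commute)
    then have "Poly_Mapping.single u 1 \<in> carrier ?R"
      by (auto simp: poly_ring_def ring_on_def)
    moreover have "Poly_Mapping.single a 1 \<in> Idl\<^bsub>?R\<^esub> ?G"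
      using genideal_self[OF G] a by blast
    ultimately have "Poly_Mapping.single a 1 \<otimes>\<^bsub>?R\<^esub> Poly_Mapping.single u 1 \<in> Idl\<^bsub>?R\<^esub> ?G"
      by (rule ideal.I_r_closed[OF genideal_ideal[OF G], rotated])
    then show "Poly_Mapping.single m 1 \<in> Idl\<^bsub>?R\<^esub> ?G"
      by (simp add: poly_ring_def ring_on_def mult_single u)
  qed
qed


section \<open>Leading monomials\<close>

locale mon_order =
  fixes V :: "'z set" and r :: "'z monomial rel"
  assumes order: "monomial_order V r"
begin

lemma order_r:
  "r \<subseteq> monomials V \<times> monomials V" "refl_on (monomials V) r" "trans r" "antisym r"
  "total_on (monomials V) r"
  using order
  by (simp_all add: monomial_order_def linear_order_on_def partial_order_on_def preorder_on_def)

lemma refl_r: "m \<in> monomials V \<Longrightarrow> (m, m) \<in> r"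
  using order_r(2) by (simp add: refl_on_def)

lemma trans_r: "(a, b) \<in> r \<Longrightarrow> (b, c) \<in> r \<Longrightarrow> (a, c) \<in> r"
  using order_r(3) by (rule transD)

lemma antisym_r: "(a, b) \<in> r \<Longrightarrow> (b, a) \<in> r \<Longrightarrow> a = b"
  using order_r(4) by (rule antisymD)

lemma total_r: "a \<in> monomials V \<Longrightarrow> b \<in> monomials V \<Longrightarrow> (a, b) \<in> r \<or> (b, a) \<in> r"
  using order_r(5) refl_r unfolding total_on_def by metis

lemma zero_r: "m \<in> monomials V \<Longrightarrow> (0, m) \<in> r"
  and add_r: "(a, b) \<in> r \<Longrightarrow> u \<in> monomials V \<Longrightarrow> (a + u, b + u) \<in> r"
  using order by (simp_all add: monomial_order_def)

lemma least_exists: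
  assumes "finite M" "M \<noteq> {}" "M \<subseteq> monomials V"
  shows "\<exists>m\<in>M. \<forall>m'\<in>M. (m, m') \<in> r"
  using assms
proof (induction rule: finite_ne_induct)
  case (insert x F)
  then obtain m where m: "m \<in> F" "\<forall>m'\<in>F. (m, m') \<in> r" by auto
  show ?case
    using total_r[of m x] refl_r[of x] m insert.prems by (auto intro: trans_r)
qed (use refl_r in auto)

lemma greatest_exists:
  assumes "finite M" "M \<noteq> {}" "M \<subseteq> monomials V"
  shows "\<exists>m\<in>M. \<forall>m'\<in>M. (m', m) \<in> r"
  using assms
proof (induction rule: finite_ne_induct)
  case (insert x F)
  then obtain m where m: "m \<in> F" "\<forall>m'\<in>F. (m', m) \<in> r" by auto
  show ?case
    using total_r[of m x] refl_r[of x] m insert.prems by (auto intro: trans_r)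
qed (use refl_r in auto)

lemma lead_mon_eqI:
  assumes "m \<in> Poly_Mapping.keys p" "\<And>m'. m' \<in> Poly_Mapping.keys p \<Longrightarrow> (m', m) \<in> r"
  shows "lead_mon r p = m"
  unfolding lead_mon_def using assms antisym_r by (intro the_equality) auto

lemma lead_mon:
  assumes "p \<noteq> 0" "Poly_Mapping.keys p \<subseteq> monomials V"
  shows lead_mon_in_keys: "lead_mon r p \<in> Poly_Mapping.keys p"
    and lead_mon_greatest: "m \<in> Poly_Mapping.keys p \<Longrightarrow> (m, lead_mon r p) \<in> r"
  using greatest_exists[of "Poly_Mapping.keys p"] assms lead_mon_eqI by auto

lemma mon_dvd_le:
  assumes "mon_dvd a b" "b \<in> monomials V"
  shows "(a, b) \<in> r"
proof -
  obtain u where u: "b = a + u" using assms by (auto simp: mon_dvd_def)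
  then have "u \<in> monomials V" "a \<in> monomials V"
    using monomials_mon_dvd[OF assms(2)] by (auto simp: mon_dvd_def add.commute)
  then show ?thesis
    using add_r[OF zero_r, of u a] u by (simp add: add.commute)
qed

end

lemma keys_binomial:
  assumes "p \<noteq> q"
  shows "Poly_Mapping.keys (Poly_Mapping.single p 1 - Poly_Mapping.single q (1::'k::field)) = {p, q}"
  using assms by (auto simp: in_keys_iff lookup_minus lookup_single when_def split: if_splits)

lemma binomial_eq_0_iff:
  "Poly_Mapping.single p 1 - Poly_Mapping.single q (1::'k::field) = 0 \<longleftrightarrow> p = q"
  using keys_binomial[of p q, where 'k = 'k] by (metis diff_self insert_not_empty keys_zero)

text \<open>Both initial ideals are generated by monomials, so one inclusion is trivial and the other can be
  tested on the generators, where membership means divisibility.\<close>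

lemma groebner_basis_iff:
  fixes J :: "('z, 'k::field) mpoly set"
  assumes "monomial_order V r" and J: "\<And>f. f \<in> J \<Longrightarrow> Poly_Mapping.keys f \<subseteq> monomials V"
  shows "groebner_basis V r J B \<longleftrightarrow> finite B \<and> B \<subseteq> J \<and> 0 \<notin> B \<and>
           (\<forall>f\<in>J. f \<noteq> 0 \<longrightarrow> (\<exists>g\<in>B. mon_dvd (lead_mon r g) (lead_mon r f)))"
proof -
  interpret mon_order V r by standard fact
  interpret ring "poly_ring V :: ('z, 'k) mpoly ring" by (rule ring_poly_ring)
  let ?L = "\<lambda>F. {lead_mon r f | f. f \<in> F \<and> f \<noteq> (0 :: ('z, 'k) mpoly)}"
  let ?S = "\<lambda>A. {Poly_Mapping.single a (1::'k) | a. a \<in> A}"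
  have L: "?L F \<subseteq> monomials V" if "F \<subseteq> J" for F
    using that lead_mon_in_keys J by blast
  have ini: "initial_ideal V r F = Idl\<^bsub>poly_ring V\<^esub> ?S (?L F)" for F :: "('z, 'k) mpoly set"
    unfolding initial_ideal_def by (rule arg_cong[where f = "genideal _"]) blast
  have carr: "?S (?L F) \<subseteq> carrier (poly_ring V)" if "F \<subseteq> J" for F
    using L[OF that] by (auto simp: poly_ring_def ring_on_def)
  have "initial_ideal V r B = initial_ideal V r J \<longleftrightarrow>
          (\<forall>f\<in>J. f \<noteq> 0 \<longrightarrow> (\<exists>g\<in>B. mon_dvd (lead_mon r g) (lead_mon r f)))" (is "_ \<longleftrightarrow> ?R")
    if B: "B \<subseteq> J" "0 \<notin> B"
  proof
    assume eq: "initial_ideal V r B = initial_ideal V r J"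
    show ?R
    proof (intro ballI impI)
      fix f assume f: "f \<in> J" "f \<noteq> 0"
      then have "Poly_Mapping.single (lead_mon r f) 1 \<in> Idl\<^bsub>poly_ring V\<^esub> ?S (?L B)"
        using genideal_self[OF carr[OF subset_refl]] eq unfolding ini by blast
      then have "\<exists>a\<in>?L B. mon_dvd a (lead_mon r f)"
        using single_in_monomial_ideal_iff[OF L[OF B(1)], of "lead_mon r f"] L[OF subset_refl] f by blast
      then show "\<exists>g\<in>B. mon_dvd (lead_mon r g) (lead_mon r f)"
        by blast
    qed
  next
    assume R: ?R
    have "?S (?L J) \<subseteq> Idl\<^bsub>poly_ring V\<^esub> ?S (?L B)"
    proof
      fix s assume "s \<in> ?S (?L J)"
      then obtain f where f: "f \<in> J" "f \<noteq> 0" "s = Poly_Mapping.single (lead_mon r f) 1"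
        by blast
      then obtain g where "g \<in> B" "mon_dvd (lead_mon r g) (lead_mon r f)"
        using R by blast
      then have "\<exists>a\<in>?L B. mon_dvd a (lead_mon r f)"
        using B by blast
      then show "s \<in> Idl\<^bsub>poly_ring V\<^esub> ?S (?L B)"
        using single_in_monomial_ideal_iff[OF L[OF B(1)], of "lead_mon r f"] L[OF subset_refl] f by blast
    qed
    then have "initial_ideal V r J \<subseteq> initial_ideal V r B"
      unfolding ini by (rule genideal_minimal[OF genideal_ideal[OF carr[OF B(1)]]])
    moreover have "?S (?L B) \<subseteq> ?S (?L J)"
      using B by blast
    then have "initial_ideal V r B \<subseteq> initial_ideal V r J"
      using subset_Idl_subset[OF carr[OF subset_refl]] unfolding ini by blast
    ultimately show "initial_ideal V r B = initial_ideal V r J" by blast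
  qed
  then show ?thesis unfolding groebner_basis_def by blast
qed


section \<open>Toric ideals with rigid circuits\<close>

text \<open>The ideal \<open>J\<close> is the kernel of a map that sends a monomial \<open>m\<close> to a monomial of degree \<open>deg m\<close>,
  so that everything about \<open>J\<close> can be read off the fibres of \<open>deg\<close>. The pairs in \<open>C\<close> are the two
  sides of the circuits: by \<open>conformal\<close>, any two monomials of a fibre are divisible by the two sides
  of a circuit, and by \<open>rigid\<close>, two monomials of a fibre within the support of a circuit are
  divisible by the two sides of this very circuit.\<close>

locale toric_circuits =
  fixes V :: "'z set" and J :: "('z, 'k::field) mpoly set"
    and deg :: "'z monomial \<Rightarrow> 'd" and C :: "('z monomial \<times> 'z monomial) set"
  assumes finite_V: "finite V"
    and J_monomials: "f \<in> J \<Longrightarrow> Poly_Mapping.keys f \<subseteq> monomials V"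
    and J_fibre: "f \<in> J \<Longrightarrow> m \<in> Poly_Mapping.keys f \<Longrightarrow>
                    \<exists>m'\<in>Poly_Mapping.keys f. m' \<noteq> m \<and> deg m' = deg m"
    and J_binomial: "m \<in> monomials V \<Longrightarrow> m' \<in> monomials V \<Longrightarrow> deg m = deg m' \<Longrightarrow>
                    Poly_Mapping.single m 1 - Poly_Mapping.single m' 1 \<in> J"
    and J_diff: "f \<in> J \<Longrightarrow> g \<in> J \<Longrightarrow> f - g \<in> J"
    and deg_add: "deg m = deg m' \<Longrightarrow> deg (m + u) = deg (m' + u)"
    and finite_fibre: "finite {m \<in> monomials V. deg m = d}"
    and finite_C: "finite C"
    and circuit: "(p, q) \<in> C \<Longrightarrow>
          p \<in> monomials V \<and> q \<in> monomials V \<and> deg p = deg q \<and> p \<noteq> 0 \<and> q \<noteq> 0 \<and>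
          Poly_Mapping.keys p \<inter> Poly_Mapping.keys q = {}"
    and conformal: "m \<in> monomials V \<Longrightarrow> m' \<in> monomials V \<Longrightarrow> deg m = deg m' \<Longrightarrow> m \<noteq> m' \<Longrightarrow>
          \<exists>p q. (p, q) \<in> C \<and> mon_dvd p m \<and> mon_dvd q m'"
    and rigid: "(p, q) \<in> C \<Longrightarrow> m \<noteq> m' \<Longrightarrow> deg m = deg m' \<Longrightarrow>
          Poly_Mapping.keys m \<union> Poly_Mapping.keys m' \<subseteq> Poly_Mapping.keys p \<union> Poly_Mapping.keys q \<Longrightarrow>
          mon_dvd p m \<and> mon_dvd q m' \<or> mon_dvd q m \<and> mon_dvd p m'"
begin

lemma circuit_neq: "(p, q) \<in> C \<Longrightarrow> p \<noteq> q"
  using circuit[of p q] by auto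

text \<open>The least monomials of the degree fibres; they are the monomials outside the initial ideal.\<close>

definition standard :: "'z monomial rel \<Rightarrow> 'z monomial \<Rightarrow> bool" where
  "standard r m \<longleftrightarrow> (\<forall>m'\<in>monomials V. deg m' = deg m \<longrightarrow> (m, m') \<in> r)"

text \<open>The minimal monomial generators of the initial ideal.\<close>

definition minimal_nonstandard :: "'z monomial rel \<Rightarrow> 'z monomial \<Rightarrow> bool" where
  "minimal_nonstandard r m \<longleftrightarrow> m \<in> monomials V \<and> \<not> standard r m \<and>
     (\<forall>p\<in>monomials V. \<not> standard r p \<longrightarrow> mon_dvd p m \<longrightarrow> p = m)"

context
  fixes r :: "'z monomial rel"
  assumes order: "monomial_order V r"
begin

interpretation mon_order V r
  by standard (rule order)

lemma groebner_basis_J_iff: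
  "groebner_basis V r J B \<longleftrightarrow> finite B \<and> B \<subseteq> J \<and> 0 \<notin> B \<and>
     (\<forall>f\<in>J. f \<noteq> 0 \<longrightarrow> (\<exists>g\<in>B. mon_dvd (lead_mon r g) (lead_mon r f)))"
  by (rule groebner_basis_iff[OF order J_monomials])

text \<open>Since no fibre meets \<open>f\<close> in a single monomial, the fibre of the leading monomial contains a
  smaller one.\<close>

lemma not_standard_lead_mon:
  assumes "f \<in> J" "f \<noteq> 0"
  shows "\<not> standard r (lead_mon r f)"
proof -
  have lm: "lead_mon r f \<in> Poly_Mapping.keys f"
    using lead_mon_in_keys assms J_monomials by blast
  then obtain m where m: "m \<in> Poly_Mapping.keys f" "m \<noteq> lead_mon r f" "deg m = deg (lead_mon r f)"
    using J_fibre assms by blast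
  have "(m, lead_mon r f) \<in> r"
    using lead_mon_greatest assms J_monomials m by blast
  then show ?thesis
    using m J_monomials[OF assms(1)] antisym_r unfolding standard_def by blast
qed

lemma not_standardD:
  assumes "\<not> standard r m" "m \<in> monomials V"
  shows "\<exists>m'\<in>monomials V. deg m' = deg m \<and> m' \<noteq> m \<and> (m', m) \<in> r"
  using assms total_r refl_r unfolding standard_def by metis

lemma lead_mon_binomial:
  assumes "(q, p) \<in> r" "p \<noteq> q"
  shows "lead_mon r (Poly_Mapping.single p 1 - Poly_Mapping.single q (1::'k)) = p"
  using assms refl_r order_r(1) by (intro lead_mon_eqI) (auto simp: keys_binomial)

text \<open>Multiplying a competitor of the divisor by the cofactor gives a competitor of the multiple.\<close>

lemma standard_mon_dvd:
  assumes "standard r m" "m \<in> monomials V" "mon_dvd p m"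
  shows "standard r p"
proof (rule ccontr)
  assume "\<not> standard r p"
  moreover have p: "p \<in> monomials V"
    using assms monomials_mon_dvd by blast
  ultimately obtain p' where p': "p' \<in> monomials V" "deg p' = deg p" "p' \<noteq> p" "(p', p) \<in> r"
    using not_standardD by blast
  obtain u where u: "m = p + u" "u \<in> monomials V"
    using assms(2,3) monomials_mon_dvd by (metis mon_dvd_def add.commute)
  have "(p' + u, p + u) \<in> r"
    using add_r p' u by blast
  moreover have "(p + u, p' + u) \<in> r"
    using assms(1) deg_add[OF p'(2)] monomials_add[OF p'(1) u(2)] u unfolding standard_def by blast
  ultimately show False
    using antisym_r p'(3) by fastforce
qed

text \<open>A minimal generator \<open>m\<close> of the initial ideal is joined to the least monomial of its fibre by
  a circuit. The far end of the circuit divides a standard monomial, hence is standard; so the near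
  end is not standard, and by minimality it is all of \<open>m\<close>.\<close>

lemma minimal_nonstandard_circuit:
  assumes "minimal_nonstandard r m"
  shows "\<exists>q. (m, q) \<in> C \<and> standard r q"
proof -
  have m: "m \<in> monomials V" "\<not> standard r m"
    using assms by (auto simp: minimal_nonstandard_def)
  obtain m' where m': "m' \<in> monomials V" "deg m' = deg m"
    and least: "\<And>a. a \<in> monomials V \<Longrightarrow> deg a = deg m \<Longrightarrow> (m', a) \<in> r"
    using least_exists[OF finite_fibre[of "deg m"]] m by auto
  have st: "standard r m'"
    using least m' by (auto simp: standard_def)
  then obtain p q where pq: "(p, q) \<in> C" "mon_dvd p m" "mon_dvd q m'"
    using conformal m m' by metis
  have q: "standard r q"
    using standard_mon_dvd[OF st m'(1) pq(3)] .
  have "\<not> standard r p"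
    using q circuit[OF pq(1)] circuit_neq[OF pq(1)] antisym_r unfolding standard_def by metis
  then show ?thesis
    using pq q assms circuit[OF pq(1)] unfolding minimal_nonstandard_def by blast
qed

lemma standard_unique:
  assumes "standard r m" "standard r m'" "m \<in> monomials V" "m' \<in> monomials V" "deg m = deg m'"
  shows "m = m'"
  using assms antisym_r unfolding standard_def by metis

lemma minimal_nonstandard_divisor:
  assumes "m \<in> monomials V" "\<not> standard r m"
  shows "\<exists>p. minimal_nonstandard r p \<and> mon_dvd p m"
  using mon_dvd_minimal_divisor[of "\<lambda>p. p \<in> monomials V \<and> \<not> standard r p" m] assms
  unfolding minimal_nonstandard_def by blast

text \<open>The binomial of a circuit joining a minimal generator of the initial ideal to a standard
  monomial and the basis element with this leading monomial differ by an element of \<open>J\<close> without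
  nonstandard monomials, that is, by zero.\<close>

lemma reduced_groebner_basis_circuit:
  assumes B: "reduced_groebner_basis V r J B" and g: "g \<in> B"
  shows "\<exists>p q. (p, q) \<in> C \<and> g = Poly_Mapping.single p 1 - Poly_Mapping.single q 1"
proof -
  have "groebner_basis V r J B"
    using B unfolding reduced_groebner_basis_def by blast
  then have gb: "B \<subseteq> J" "0 \<notin> B"
    and div: "f \<in> J \<Longrightarrow> f \<noteq> 0 \<Longrightarrow> \<exists>h\<in>B. mon_dvd (lead_mon r h) (lead_mon r f)" for f
    by (simp_all add: groebner_basis_J_iff)
  have lc: "Poly_Mapping.lookup g (lead_mon r g) = 1"
    using B g unfolding reduced_groebner_basis_def lead_coef_def by blast
  have red: "\<not> mon_dvd (lead_mon r h) m" if "h \<in> B" "h \<noteq> g" "m \<in> Poly_Mapping.keys g" for h m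
    using B g that unfolding reduced_groebner_basis_def mon_dvd_def by blast
  have gJ: "g \<in> J" "g \<noteq> 0" using g gb by auto
  have keys: "Poly_Mapping.keys g \<subseteq> monomials V" using J_monomials gJ by blast
  note lm = lead_mon_in_keys[OF gJ(2) keys]
  have div': "\<exists>h\<in>B. mon_dvd (lead_mon r h) m" if m: "m \<in> monomials V" "\<not> standard r m" for m
  proof -
    obtain m' where m': "m' \<in> monomials V" "deg m' = deg m" "m' \<noteq> m" "(m', m) \<in> r"
      using not_standardD m by blast
    show ?thesis
      using div[OF J_binomial[OF m(1) m'(1)]] lead_mon_binomial[OF m'(4)] m'
      by (auto simp: binomial_eq_0_iff simp del: right_minus_eq)
  qed
  have tail: "standard r m" if m: "m \<in> Poly_Mapping.keys g" "m \<noteq> lead_mon r g" for m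
  proof (rule ccontr)
    assume "\<not> standard r m"
    then obtain h where h: "h \<in> B" "mon_dvd (lead_mon r h) m"
      using div' m keys by blast
    then have "mon_dvd (lead_mon r g) m"
      using red[OF h(1) _ m(1)] by auto
    then have "(lead_mon r g, m) \<in> r"
      using mon_dvd_le m keys by blast
    then show False
      using lead_mon_greatest[OF gJ(2) keys m(1)] antisym_r m(2) by blast
  qed
  have "minimal_nonstandard r (lead_mon r g)"
    unfolding minimal_nonstandard_def
  proof (intro conjI ballI impI)
    fix p assume p: "p \<in> monomials V" "\<not> standard r p" "mon_dvd p (lead_mon r g)"
    then obtain h where h: "h \<in> B" "mon_dvd (lead_mon r h) p"
      using div' by blast
    then have "h = g"
      using red[OF h(1) _ lm] mon_dvd_trans[OF h(2) p(3)] by blast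
    then show "p = lead_mon r g"
      using h p mon_dvd_antisym by blast
  qed (use lm keys not_standard_lead_mon gJ in auto)
  then obtain q where q: "(lead_mon r g, q) \<in> C" "standard r q"
    using minimal_nonstandard_circuit by blast
  let ?b = "Poly_Mapping.single (lead_mon r g) 1 - Poly_Mapping.single q (1::'k)"
  have "g = ?b"
  proof (rule ccontr)
    assume neq: "g \<noteq> ?b"
    have d: "g - ?b \<in> J"
      using J_diff[OF gJ(1)] J_binomial circuit[OF q(1)] by blast
    have nz: "g - ?b \<noteq> 0"
      using neq by simp
    note ns = not_standard_lead_mon[OF d nz]
      and k = lead_mon_in_keys[OF nz J_monomials[OF d]]
    have "lead_mon r (g - ?b) \<noteq> lead_mon r g"
      using k lc circuit_neq[OF q(1)]
      by (auto simp: in_keys_iff lookup_minus lookup_single)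
    moreover have "lead_mon r (g - ?b) \<noteq> q"
      using ns q(2) by auto
    ultimately have "lead_mon r (g - ?b) \<in> Poly_Mapping.keys g"
      using k by (auto simp: in_keys_iff lookup_minus lookup_single)
    then show False
      using tail ns \<open>lead_mon r (g - ?b) \<noteq> lead_mon r g\<close> by blast
  qed
  then show ?thesis using q by blast
qed

text \<open>Each minimal generator \<open>p\<close> of the initial ideal occurs in exactly one of these binomials,
  because a fibre has only one standard monomial; this makes the set reduced.\<close>

lemma standard_circuits_reduced_groebner_basis:
  "reduced_groebner_basis V r J
     {Poly_Mapping.single p 1 - Poly_Mapping.single q 1 | p q.
        (p, q) \<in> C \<and> minimal_nonstandard r p \<and> standard r q}" (is "reduced_groebner_basis _ _ _ ?B")
proof -
  have less: "(q, p) \<in> r" "p \<noteq> q" if "(p, q) \<in> C" "standard r q" for p q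
    using that circuit[of p q] circuit_neq[of p q] unfolding standard_def by auto
  have lm: "lead_mon r (Poly_Mapping.single p 1 - Poly_Mapping.single q (1::'k)) = p"
    if "(p, q) \<in> C" "standard r q" for p q
    using lead_mon_binomial[OF less] that by blast
  have "groebner_basis V r J ?B"
    unfolding groebner_basis_J_iff
  proof (intro conjI ballI impI)
    have "?B \<subseteq> (\<lambda>(p, q). Poly_Mapping.single p 1 - Poly_Mapping.single q 1) ` C"
      by auto
    then show "finite ?B"
      using finite_C finite_surj by blast
    show "?B \<subseteq> J"
      using J_binomial circuit by blast
    show "0 \<notin> ?B"
      using circuit_neq binomial_eq_0_iff[where 'k = 'k] by fastforce
  next
    fix f assume f: "f \<in> J" "f \<noteq> 0"
    then have "lead_mon r f \<in> monomials V"
      using lead_mon_in_keys J_monomials by blast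
    then obtain p where p: "minimal_nonstandard r p" "mon_dvd p (lead_mon r f)"
      using minimal_nonstandard_divisor not_standard_lead_mon[OF f] by blast
    obtain q where q: "(p, q) \<in> C" "standard r q"
      using minimal_nonstandard_circuit[OF p(1)] by blast
    show "\<exists>g\<in>?B. mon_dvd (lead_mon r g) (lead_mon r f)"
      using p q lm[OF q] by (intro bexI[of _ "Poly_Mapping.single p 1 - Poly_Mapping.single q 1"]) auto
  qed
  moreover have "lead_coef r g = 1" if g: "g \<in> ?B" for g
  proof -
    obtain p q where "(p, q) \<in> C" "standard r q" "g = Poly_Mapping.single p 1 - Poly_Mapping.single q 1"
      using g by blast
    then show ?thesis
      using lm[of p q] less[of p q]
      by (simp add: lead_coef_def lookup_minus lookup_single)
  qed
  moreover have "\<not> (\<exists>u. m = lead_mon r g + u)"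
    if gh: "g \<in> ?B" "h \<in> ?B" "g \<noteq> h" and m: "m \<in> Poly_Mapping.keys h" for g h m
  proof -
    obtain p q where g: "(p, q) \<in> C" "minimal_nonstandard r p" "standard r q"
        "g = Poly_Mapping.single p 1 - Poly_Mapping.single q 1"
      using gh by blast
    obtain p' q' where h: "(p', q') \<in> C" "minimal_nonstandard r p'" "standard r q'"
        "h = Poly_Mapping.single p' 1 - Poly_Mapping.single q' 1"
      using gh by blast
    have "m = p' \<or> m = q'"
      using m h(4) keys_binomial[OF circuit_neq[OF h(1)], where 'k = 'k] by simp
    moreover have "\<not> mon_dvd p p'"
    proof
      assume "mon_dvd p p'"
      then have "p = p'"
        using g(2) h(2) unfolding minimal_nonstandard_def by blast
      moreover from this have "q = q'"
        using standard_unique[OF g(3) h(3)] circuit[OF g(1)] circuit[OF h(1)] by metis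
      ultimately show False using gh(3) g(4) h(4) by blast
    qed
    moreover have "\<not> mon_dvd p q'"
      using standard_mon_dvd[OF h(3)] g(2) circuit[OF h(1)]
      unfolding minimal_nonstandard_def by blast
    ultimately show ?thesis
      using lm[OF g(1,3)] g(4) unfolding mon_dvd_def by metis
  qed
  ultimately show ?thesis
    unfolding reduced_groebner_basis_def by blast
qed

text \<open>If the variables outside a circuit are eliminated first, what lies below a divisor of one of its
  sides stays inside its support, where rigidity leaves only the circuit itself.\<close>

lemma eliminated_circuit_standard:
  assumes pq: "(p, q) \<in> C" and less: "(q, p) \<in> r"
    and elim: "\<And>m m'. (m', m) \<in> r \<Longrightarrow>
        Poly_Mapping.keys m \<subseteq> Poly_Mapping.keys p \<union> Poly_Mapping.keys q \<Longrightarrow>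
        Poly_Mapping.keys m' \<subseteq> Poly_Mapping.keys p \<union> Poly_Mapping.keys q"
  shows "minimal_nonstandard r p" "standard r q"
proof -
  note c = circuit[OF pq] circuit_neq[OF pq]
  have disjoint_dvd: "\<not> mon_dvd p q" "\<not> mon_dvd q p"
    using c(1) keys_mono_mon_dvd[of p q] keys_mono_mon_dvd[of q p]
    by (metis Int_absorb1 Int_absorb2 keys_eq_empty)+
  have split: "mon_dvd p m \<and> mon_dvd q m' \<or> mon_dvd q m \<and> mon_dvd p m'"
    if "m' \<noteq> m" "deg m' = deg m" "(m', m) \<in> r"
      "Poly_Mapping.keys m \<subseteq> Poly_Mapping.keys p \<union> Poly_Mapping.keys q" for m m'
    using rigid[OF pq, of m m'] elim[of m' m] that by auto
  show "minimal_nonstandard r p"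
    unfolding minimal_nonstandard_def
  proof (intro conjI ballI impI)
    show "p \<in> monomials V" using c by blast
    show "\<not> standard r p" using c less antisym_r unfolding standard_def by metis
  next
    fix m assume m: "m \<in> monomials V" "\<not> standard r m" "mon_dvd m p"
    then obtain m' where "m' \<in> monomials V" "deg m' = deg m" "m' \<noteq> m" "(m', m) \<in> r"
      using not_standardD by blast
    then have "mon_dvd p m \<or> mon_dvd q m"
      using split keys_mono_mon_dvd[OF m(3)] by blast
    then show "m = p"
      using m(3) mon_dvd_antisym mon_dvd_trans disjoint_dvd(2) by blast
  qed
  show "standard r q"
  proof (rule ccontr)
    assume "\<not> standard r q"
    then obtain m' where m': "m' \<in> monomials V" "deg m' = deg q" "m' \<noteq> q" "(m', q) \<in> r"
      using not_standardD c by blast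
    then have "mon_dvd p m'"
      using split[of m' q] disjoint_dvd by blast
    then have "(p, q) \<in> r"
      using mon_dvd_le[OF _ m'(1)] m'(4) trans_r by blast
    then show False
      using less antisym_r c by blast
  qed
qed

end

end


section \<open>Lexicographic orders\<close>

fun lex_le :: "'z list \<Rightarrow> 'z monomial \<Rightarrow> 'z monomial \<Rightarrow> bool" where
  "lex_le [] a b \<longleftrightarrow> True"
| "lex_le (z # zs) a b \<longleftrightarrow> Poly_Mapping.lookup a z < Poly_Mapping.lookup b z \<or>
     Poly_Mapping.lookup a z = Poly_Mapping.lookup b z \<and> lex_le zs a b"

lemma lex_le_refl: "lex_le zs a a"
  by (induction zs) auto

lemma lex_le_trans: "lex_le zs a b \<Longrightarrow> lex_le zs b c \<Longrightarrow> lex_le zs a c"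
  by (induction zs) auto

lemma lex_le_total: "lex_le zs a b \<or> lex_le zs b a"
  by (induction zs) auto

lemma lex_le_antisym:
  "lex_le zs a b \<Longrightarrow> lex_le zs b a \<Longrightarrow> z \<in> set zs \<Longrightarrow> Poly_Mapping.lookup a z = Poly_Mapping.lookup b z"
  by (induction zs) auto

lemma lex_le_zero: "lex_le zs 0 a"
  by (induction zs) auto

lemma lex_le_add: "lex_le zs a b \<Longrightarrow> lex_le zs (a + u) (b + u)"
  by (induction zs) (auto simp: lookup_add)

lemma lex_le_append_eliminates:
  "lex_le (zs @ zs') a b \<Longrightarrow> \<forall>z\<in>set zs. Poly_Mapping.lookup b z = 0 \<Longrightarrow> z \<in> set zs \<Longrightarrow>
     Poly_Mapping.lookup a z = 0"
  by (induction zs) auto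

lemma lex_le_append_eq:
  "\<forall>z\<in>set zs. Poly_Mapping.lookup a z = Poly_Mapping.lookup b z \<Longrightarrow>
     lex_le (zs @ zs') a b \<longleftrightarrow> lex_le zs' a b"
  by (induction zs) auto

definition lex_order :: "'z list \<Rightarrow> 'z monomial rel" where
  "lex_order zs = {(a, b). a \<in> monomials (set zs) \<and> b \<in> monomials (set zs) \<and> lex_le zs a b}"

lemma monomial_order_lex_order: "monomial_order (set zs) (lex_order zs)"
proof -
  have "a = b" if "a \<in> monomials (set zs)" "b \<in> monomials (set zs)" "lex_le zs a b" "lex_le zs b a" for a b
  proof (rule poly_mapping_eqI)
    fix z show "Poly_Mapping.lookup a z = Poly_Mapping.lookup b z"
    proof (cases "z \<in> set zs")
      case False
      then show ?thesis
        using that by (metis in_keys_iff mem_Collect_eq monomials_def subsetD)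
    qed (use that lex_le_antisym[of zs a b z] in blast)
  qed
  then have "antisym (lex_order zs)"
    by (auto simp: lex_order_def antisym_def)
  then show ?thesis
    unfolding monomial_order_def linear_order_on_def partial_order_on_def preorder_on_def
      refl_on_def trans_def total_on_def
    by (auto simp: lex_order_def monomials_add lex_le_refl lex_le_zero intro: lex_le_trans lex_le_add)
      (use lex_le_total in blast, simp add: monomials_def)
qed


context toric_circuits
begin

text \<open>A lexicographic order does it: the variables outside the circuit come first, so that they are
  eliminated, and the next one is a variable of \<open>p\<close>; it does not occur in \<open>q\<close>, which makes \<open>p\<close>
  lead.\<close>

lemma circuit_elimination_order:
  assumes pq: "(p, q) \<in> C"
  shows "\<exists>r. monomial_order V r \<and> minimal_nonstandard r p \<and> standard r q"
proof -
  note c = circuit[OF pq]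
  let ?S = "Poly_Mapping.keys p \<union> Poly_Mapping.keys q"
  obtain z0 where z0: "z0 \<in> Poly_Mapping.keys p"
    using c by (metis equals0I keys_eq_empty)
  have z0q: "Poly_Mapping.lookup q z0 = 0"
    using c z0 by (auto simp: in_keys_iff)
  obtain zs where zs: "set zs = V - ?S"
    using finite_list finite_V by (metis finite_Diff)
  obtain ws where ws: "set ws = ?S"
    using finite_list[of ?S] by auto
  let ?l = "zs @ z0 # ws"
  have V: "set ?l = V"
    using zs ws z0 c by (auto simp: monomials_def)
  have ord: "monomial_order V (lex_order ?l)"
    using monomial_order_lex_order[of ?l] unfolding V .
  have off: "Poly_Mapping.lookup p z = 0" "Poly_Mapping.lookup q z = 0" if "z \<in> set zs" for z
    using that zs by (auto simp: in_keys_iff)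
  have "lex_le ?l q p"
    using z0 z0q off by (subst lex_le_append_eq) (auto simp: in_keys_iff)
  then have less: "(q, p) \<in> lex_order ?l"
    using c V by (simp add: lex_order_def)
  have elim: "Poly_Mapping.keys m' \<subseteq> ?S" if m: "(m', m) \<in> lex_order ?l" "Poly_Mapping.keys m \<subseteq> ?S" for m m'
  proof -
    have "Poly_Mapping.lookup m' z = 0" if "z \<in> set zs" for z
    proof (rule lex_le_append_eliminates[OF _ _ that])
      show "lex_le ?l m' m" using m by (simp add: lex_order_def)
      show "\<forall>z\<in>set zs. Poly_Mapping.lookup m z = 0"
        using m(2) zs by (metis DiffD2 in_keys_iff subsetD)
    qed
    moreover have "Poly_Mapping.keys m' \<subseteq> V"
      using m(1) V by (simp add: lex_order_def monomials_def)
    ultimately show ?thesis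
      using zs by (metis (no_types, lifting) DiffI in_keys_iff subset_iff)
  qed
  have "minimal_nonstandard (lex_order ?l) p" "standard (lex_order ?l) q"
    by (rule eliminated_circuit_standard[OF ord pq less], rule elim; assumption)+
  then show ?thesis
    using ord by blast
qed

theorem universal_groebner_basis_circuits:
  "universal_groebner_basis V J = {Poly_Mapping.single p 1 - Poly_Mapping.single q 1 | p q. (p, q) \<in> C}"
proof
  show "universal_groebner_basis V J
      \<subseteq> {Poly_Mapping.single p 1 - Poly_Mapping.single q 1 | p q. (p, q) \<in> C}"
    unfolding universal_groebner_basis_def using reduced_groebner_basis_circuit by blast
  show "{Poly_Mapping.single p 1 - Poly_Mapping.single q 1 | p q. (p, q) \<in> C}
      \<subseteq> universal_groebner_basis V J"
  proof
    fix g assume "g \<in> {Poly_Mapping.single p 1 - Poly_Mapping.single q (1::'k) | p q. (p, q) \<in> C}"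
    then obtain p q where pq: "(p, q) \<in> C" "g = Poly_Mapping.single p 1 - Poly_Mapping.single q 1"
      by blast
    then obtain r where r: "monomial_order V r" "minimal_nonstandard r p" "standard r q"
      using circuit_elimination_order by blast
    then show "g \<in> universal_groebner_basis V J"
      unfolding universal_groebner_basis_def
      using standard_circuits_reduced_groebner_basis[OF r(1)] pq by blast
  qed
qed

end


section \<open>Alternating cycles of a bipartite graph\<close>

text \<open>On a finite set the orbit of some point returns to it. The points up to the first return are
  distinct, and \<open>f\<close> moves each of them to the next one.\<close>

lemma function_cycle:
  assumes P: "finite P" "P \<noteq> {}" "\<And>x. x \<in> P \<Longrightarrow> f x \<in> P"
  shows "\<exists>xs. xs \<noteq> [] \<and> distinct xs \<and> set xs \<subseteq> P \<and> map f xs = rotate1 xs"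
proof -
  obtain x where x: "x \<in> P" using P by blast
  have inP: "y \<in> P \<Longrightarrow> (f ^^ n) y \<in> P" for n y
    by (induction n) (use P in auto)
  have "range (\<lambda>n. (f ^^ n) x) \<subseteq> P"
    using inP[OF x] by blast
  then have "\<not> inj (\<lambda>n. (f ^^ n) x)"
    using finite_imageD[OF finite_subset[OF _ P(1)], of "\<lambda>n. (f ^^ n) x" "UNIV :: nat set"] by auto
  then obtain i j where ij: "i < j" "(f ^^ i) x = (f ^^ j) x"
    using linorder_inj_onI'[of UNIV "\<lambda>n. (f ^^ n) x"] by blast
  define y where "y = (f ^^ i) x"
  have "(f ^^ (j - i)) y = (f ^^ (j - i + i)) x"
    by (simp only: y_def funpow_add o_apply)
  also have "\<dots> = y"
    using ij by (simp add: y_def)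
  finally have per: "\<exists>n. 0 < n \<and> (f ^^ n) y = y"
    using ij(1) by (intro exI[of _ "j - i"]) simp
  define n where "n = (LEAST n. 0 < n \<and> (f ^^ n) y = y)"
  have n: "0 < n" "(f ^^ n) y = y"
    using LeastI_ex[OF per] unfolding n_def by auto
  have least: "\<not> (0 < k \<and> (f ^^ k) y = y)" if "k < n" for k
    using not_less_Least that unfolding n_def by blast
  let ?xs = "map (\<lambda>k. (f ^^ k) y) [0..<n]"
  have "(f ^^ a) y \<noteq> (f ^^ b) y" if "a < b" "b < n" for a b
  proof
    assume eq: "(f ^^ a) y = (f ^^ b) y"
    have "(f ^^ (n - b + a)) y = (f ^^ (n - b)) ((f ^^ b) y)"
      by (simp add: funpow_add eq)
    also have "\<dots> = (f ^^ (n - b + b)) y"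
      by (simp only: funpow_add o_apply)
    also have "\<dots> = y"
      using n that by simp
    finally have "(f ^^ (n - b + a)) y = y" .
    moreover have "n - b + a < n" "0 < n - b + a"
      using that by linarith+
    ultimately show False
      using least by blast
  qed
  then have "inj_on (\<lambda>k. (f ^^ k) y) {0..<n}"
    by (intro linorder_inj_onI') auto
  then have "distinct ?xs"
    by (simp add: distinct_map)
  moreover have "map f ?xs = rotate1 ?xs"
  proof (rule nth_equalityI)
    fix k assume "k < length (map f ?xs)"
    then show "map f ?xs ! k = rotate1 ?xs ! k"
      using n by (cases "Suc k = n") (auto simp: nth_rotate1 simp del: funpow.simps(2)
        simp flip: funpow.simps(2)[THEN fun_cong, unfolded o_apply])
  qed simp
  moreover have "set ?xs \<subseteq> P"
    using inP x y_def by auto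
  ultimately show ?thesis
    using n(1) by (intro exI[of _ ?xs]) auto
qed

text \<open>The cycle \<open>(x\<^sub>1, y\<^sub>1, x\<^sub>2, y\<^sub>2, \<dots>, x\<^sub>k, y\<^sub>k, x\<^sub>1)\<close> is kept as the lists of its vertices on the two
  sides: \<open>zip xs ys\<close> lists every second edge, and \<open>zip (rotate1 xs) ys\<close> the remaining ones.\<close>

definition alt_cycle :: "('a \<times> 'b) set \<Rightarrow> 'a list \<Rightarrow> 'b list \<Rightarrow> bool" where
  "alt_cycle A xs ys \<longleftrightarrow> length xs = length ys \<and> 2 \<le> length xs \<and> distinct xs \<and> distinct ys \<and>
     set (zip xs ys) \<subseteq> A \<and> set (zip (rotate1 xs) ys) \<subseteq> A"

text \<open>The difference \<open>\<alpha> - \<beta>\<close> is a circulation, up to the orientation of the edges.\<close>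

definition same_vertex_sums :: "('a \<times> 'b) set \<Rightarrow> ('a \<times> 'b \<Rightarrow> nat) \<Rightarrow> ('a \<times> 'b \<Rightarrow> nat) \<Rightarrow> bool" where
  "same_vertex_sums A \<alpha> \<beta> \<longleftrightarrow>
     (\<forall>x. (\<Sum>e | e \<in> A \<and> fst e = x. \<alpha> e) = (\<Sum>e | e \<in> A \<and> fst e = x. \<beta> e)) \<and>
     (\<forall>y. (\<Sum>e | e \<in> A \<and> snd e = y. \<alpha> e) = (\<Sum>e | e \<in> A \<and> snd e = y. \<beta> e))"

lemma alt_cycle_zip_disjoint:
  assumes "alt_cycle A xs ys"
  shows "set (zip xs ys) \<inter> set (zip (rotate1 xs) ys) = {}"
proof -
  have "xs ! i \<noteq> xs ! (Suc i mod length xs)" if "i < length xs" for i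
  proof -
    have "Suc i mod length xs < length xs"
      using that by (intro mod_less_divisor) linarith
    moreover have "Suc i mod length xs \<noteq> i"
      using assms that unfolding alt_cycle_def by (cases "Suc i = length xs") auto
    ultimately show ?thesis
      using assms that nth_eq_iff_index_eq[of xs i "Suc i mod length xs"] unfolding alt_cycle_def by auto
  qed
  then show ?thesis
    using assms by (auto simp: alt_cycle_def set_zip nth_rotate1 nth_eq_iff_index_eq)
qed

lemma sum_eq_compensate:
  fixes \<alpha> \<beta> :: "'e \<Rightarrow> nat"
  assumes "finite S" "sum \<alpha> S = sum \<beta> S" "e \<in> S" "\<alpha> e < \<beta> e"
  shows "\<exists>e'\<in>S. \<beta> e' < \<alpha> e'"
proof (rule ccontr)
  assume "\<not> ?thesis"
  then have "sum \<alpha> S < sum \<beta> S"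
    using assms by (intro sum_strict_mono_ex1) (auto simp: not_less)
  then show False using assms by simp
qed

text \<open>Orient an edge from left to right where \<open>\<alpha>\<close> exceeds \<open>\<beta>\<close>, and from right to left where \<open>\<beta>\<close>
  exceeds \<open>\<alpha>\<close>. Equal vertex sums mean that a vertex which is entered can be left again, so that a
  walk never gets stuck and closes up; its edges alternate because the graph is bipartite.\<close>

lemma exists_alt_cycle:
  assumes A: "finite A" and sums: "same_vertex_sums A \<alpha> \<beta>" and e: "e \<in> A" "\<alpha> e \<noteq> \<beta> e"
  shows "\<exists>xs ys. alt_cycle A xs ys \<and> (\<forall>e\<in>set (zip xs ys). \<beta> e < \<alpha> e) \<and>
           (\<forall>e\<in>set (zip (rotate1 xs) ys). \<alpha> e < \<beta> e)"
proof -
  have left: "\<exists>y. (x, y) \<in> A \<and> \<beta> (x, y) < \<alpha> (x, y)" if "(x, y) \<in> A" "\<alpha> (x, y) < \<beta> (x, y)" for x y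
    using sum_eq_compensate[of "{e. e \<in> A \<and> fst e = x}" \<alpha> \<beta> "(x, y)"] that A sums
    by (auto simp: same_vertex_sums_def)
  have right: "\<exists>x. (x, y) \<in> A \<and> \<alpha> (x, y) < \<beta> (x, y)" if "(x, y) \<in> A" "\<beta> (x, y) < \<alpha> (x, y)" for x y
    using sum_eq_compensate[of "{e. e \<in> A \<and> snd e = y}" \<beta> \<alpha> "(x, y)"] that A sums
    by (auto simp: same_vertex_sums_def)
  \<comment> \<open>Going to the right along \<open>f\<close> and back along \<open>h\<close> is a function on the left vertices in \<open>P\<close>. On a cycle
    of \<open>h \<circ> f\<close> the map \<open>f\<close> is injective, so the right vertices do not repeat either.\<close>
  define P where "P = {x. \<exists>y. (x, y) \<in> A \<and> \<beta> (x, y) < \<alpha> (x, y)}"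
  define f where "f x = (SOME y. (x, y) \<in> A \<and> \<beta> (x, y) < \<alpha> (x, y))" for x
  define h where "h y = (SOME x. (x, y) \<in> A \<and> \<alpha> (x, y) < \<beta> (x, y))" for y
  have f: "(x, f x) \<in> A" "\<beta> (x, f x) < \<alpha> (x, f x)" if "x \<in> P" for x
    using that someI_ex[of "\<lambda>y. (x, y) \<in> A \<and> \<beta> (x, y) < \<alpha> (x, y)"] unfolding P_def f_def by blast+
  have h: "(h (f x), f x) \<in> A" "\<alpha> (h (f x), f x) < \<beta> (h (f x), f x)" if "x \<in> P" for x
    using someI_ex[OF right[OF f[OF that]]] unfolding h_def by blast+
  have "P \<subseteq> fst ` A" by (force simp: P_def)
  then have "finite P" using A finite_surj by blast
  moreover have "P \<noteq> {}"
    using left[of "fst e" "snd e"] e unfolding P_def by (cases "\<alpha> e < \<beta> e") (auto, metis linorder_neqE_nat prod.collapse)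
  moreover have "(h \<circ> f) x \<in> P" if "x \<in> P" for x
    using left[OF h[OF that]] by (simp add: P_def)
  ultimately obtain xs where xs: "xs \<noteq> []" "distinct xs" "set xs \<subseteq> P" "map (h \<circ> f) xs = rotate1 xs"
    using function_cycle[of P "h \<circ> f"] by blast
  let ?ys = "map f xs"
  have rot: "rotate1 xs = map h ?ys" using xs(4) by simp
  have dist: "distinct ?ys"
    using rot xs(2) distinct_map by (metis distinct1_rotate)
  have "zip xs ?ys = map (\<lambda>x. (x, f x)) xs" "zip (map h ?ys) ?ys = map (\<lambda>x. (h (f x), f x)) xs"
    by (rule nth_equalityI; simp)+
  then have z1: "set (zip xs ?ys) = (\<lambda>x. (x, f x)) ` set xs"
    and z2: "set (zip (rotate1 xs) ?ys) = (\<lambda>x. (h (f x), f x)) ` set xs"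
    unfolding rot by simp_all
  have "length xs \<noteq> 1"
  proof
    assume "length xs = 1"
    then obtain x where "xs = [x]" by (auto simp: length_Suc_conv)
    then have "h (f x) = x" "x \<in> P" using xs by auto
    then show False using f[of x] h[of x] by simp
  qed
  then have "2 \<le> length xs"
    using xs(1) by (cases xs; cases "tl xs") auto
  then have "alt_cycle A xs ?ys"
    unfolding alt_cycle_def z1 z2 using dist xs f h by auto
  then show ?thesis
    unfolding atomize_conj[symmetric] using f h xs(3) z1 z2 by (intro exI[of _ xs] exI[of _ ?ys]) auto
qed

text \<open>At a vertex of the cycle only its two cycle edges can contribute to the difference of the
  vertex sums, so \<open>\<alpha> - \<beta>\<close> changes sign from each edge of the cycle to the next one.\<close>

lemma alt_cycle_rigid:
  assumes A: "finite A" and cyc: "alt_cycle A xs ys" and sums: "same_vertex_sums A \<alpha> \<beta>"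
    and off: "\<And>e. e \<in> A \<Longrightarrow> e \<notin> set (zip xs ys) \<Longrightarrow> e \<notin> set (zip (rotate1 xs) ys) \<Longrightarrow> \<alpha> e = \<beta> e"
    and e: "e \<in> A" "\<alpha> e \<noteq> \<beta> e"
  shows "(\<forall>e\<in>set (zip xs ys). \<beta> e < \<alpha> e) \<and> (\<forall>e\<in>set (zip (rotate1 xs) ys). \<alpha> e < \<beta> e) \<or>
         (\<forall>e\<in>set (zip xs ys). \<alpha> e < \<beta> e) \<and> (\<forall>e\<in>set (zip (rotate1 xs) ys). \<beta> e < \<alpha> e)"
proof -
  let ?n = "length xs"
  define d where "d e = int (\<alpha> e) - int (\<beta> e)" for e
  let ?p = "\<lambda>i. (xs ! i, ys ! i)" and ?q = "\<lambda>i. (xs ! (Suc i mod ?n), ys ! i)"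
  have len: "length ys = ?n" and n: "2 \<le> ?n" and dist: "distinct xs" "distinct ys"
    using cyc by (auto simp: alt_cycle_def)
  have z1: "set (zip xs ys) = ?p ` {..<?n}" and z2: "set (zip (rotate1 xs) ys) = ?q ` {..<?n}"
    using len by (auto simp: set_zip nth_rotate1 image_iff) (use nth_rotate1 in metis)
  have inA: "?p i \<in> A" "?q i \<in> A" if "i < ?n" for i
    using cyc that unfolding alt_cycle_def z1 z2 by auto
  have off': "d e = 0" if "e \<in> A" "e \<notin> ?p ` {..<?n}" "e \<notin> ?q ` {..<?n}" for e
    using off that unfolding z1 z2 d_def by simp
  have pq_neq: "?p i \<noteq> ?q j" if "i < ?n" "j < ?n" for i j
    using alt_cycle_zip_disjoint[OF cyc] that unfolding z1 z2 by blast
  have suc_inj: "i = j" if "i < ?n" "j < ?n" "Suc i mod ?n = Suc j mod ?n" for i j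
    using that by (cases "Suc i = ?n"; cases "Suc j = ?n") auto
  have suc: "Suc i mod ?n < ?n" for i
    using n by (intro mod_less_divisor) linarith
  have snd0: "(\<Sum>e | e \<in> A \<and> snd e = y. d e) = 0" and fst0: "(\<Sum>e | e \<in> A \<and> fst e = x. d e) = 0" for x y
    using sums unfolding same_vertex_sums_def d_def sum_subtractf of_nat_sum[symmetric] by simp_all
  have two: "d (?q i) = - d (?p i)" if i: "i < ?n" for i
  proof -
    have "(\<Sum>e | e \<in> A \<and> snd e = ys ! i. d e) = (\<Sum>e\<in>{?p i, ?q i}. d e)"
    proof (rule sum.mono_neutral_right)
      show "\<forall>e\<in>{e. e \<in> A \<and> snd e = ys ! i} - {?p i, ?q i}. d e = 0"
        using off' dist i len by (auto simp: nth_eq_iff_index_eq intro!: off')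
    qed (use A inA i in auto)
    then show ?thesis
      using snd0 pq_neq[OF i i] by simp
  qed
  have step: "d (?p (Suc i mod ?n)) = - d (?q i)" if i: "i < ?n" for i
  proof -
    let ?j = "Suc i mod ?n"
    have "(\<Sum>e | e \<in> A \<and> fst e = xs ! ?j. d e) = (\<Sum>e\<in>{?p ?j, ?q i}. d e)"
    proof (rule sum.mono_neutral_right)
      show "\<forall>e\<in>{e. e \<in> A \<and> fst e = xs ! ?j} - {?p ?j, ?q i}. d e = 0"
      proof
        fix e assume e: "e \<in> {e. e \<in> A \<and> fst e = xs ! ?j} - {?p ?j, ?q i}"
        show "d e = 0"
        proof (rule off')
          show "e \<in> A" using e by simp
          show "e \<notin> ?p ` {..<?n}"
            using e nth_eq_iff_index_eq[OF dist(1) _ suc[of i]] by auto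
          show "e \<notin> ?q ` {..<?n}"
          proof
            assume "e \<in> ?q ` {..<?n}"
            then obtain k where k: "k < ?n" "e = ?q k" by blast
            then have "Suc k mod ?n = ?j"
              using e nth_eq_iff_index_eq[OF dist(1) suc[of k] suc[of i]] by simp
            then have "k = i"
              using suc_inj[OF k(1) i] by blast
            then show False using e k by simp
          qed
        qed
      qed
    qed (use A inA i suc in auto)
    then show ?thesis
      using fst0 pq_neq[OF suc i] by simp
  qed
  have const: "d (?p i) = d (?p 0)" if "i < ?n" for i
    using that
  proof (induction i)
    case (Suc i)
    then show ?case using step[of i] two[of i] by simp
  qed simp
  have "d (?p 0) \<noteq> 0"
    using e off'[of e] const two unfolding d_def by force
  then consider "0 < d (?p 0)" | "d (?p 0) < 0" by linarith
  then show ?thesis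
  proof cases
    case 1
    then show ?thesis
      using const two unfolding z1 z2 by (force simp: d_def)
  next
    case 2
    then show ?thesis
      using const two unfolding z1 z2 by (force simp: d_def)
  qed
qed


section \<open>The degree of a monomial under the Rees map\<close>

lemma prod_single: "(\<Prod>i\<in>I. Poly_Mapping.single (f i) (1::'k::field)) = Poly_Mapping.single (\<Sum>i\<in>I. f i) 1"
  by (induction I rule: infinite_finite_induct) (auto simp: mult_single)

lemma single_power: "Poly_Mapping.single a (1::'k::field) ^ n = Poly_Mapping.single (\<Sum>i<n. a) 1"
  by (induction n) (auto simp: mult_single add.commute)

primrec vertex_weight :: "'v rees_var \<Rightarrow> 'v monomial" where
  "vertex_weight (Vert v) = Poly_Mapping.single v 1"
| "vertex_weight (Edge e) = (\<Sum>v\<in>e. Poly_Mapping.single v 1)"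

primrec t_weight :: "'v rees_var \<Rightarrow> nat" where
  "t_weight (Vert v) = 0"
| "t_weight (Edge e) = 1"

text \<open>The monomial \<open>m\<close> is sent to \<open>x\<^sup>a t\<^sup>n\<close>, where \<open>(a, n)\<close> is its degree; the inner sum is the
  \<open>lookup m z\<close>-fold multiple of the weight.\<close>

definition rees_degree :: "'v rees_var monomial \<Rightarrow> 'v monomial \<times> nat" where
  "rees_degree m =
     (\<Sum>z\<in>Poly_Mapping.keys m. \<Sum>i<Poly_Mapping.lookup m z. vertex_weight z,
      \<Sum>z\<in>Poly_Mapping.keys m. t_weight z * Poly_Mapping.lookup m z)"

lemma rees_var_image_eq_monom:
  "rees_var_image z = monom (Poly_Mapping.single (vertex_weight z) (1::'k::field)) (t_weight z)"
  by (cases z) (simp_all add: Var_def edge_monomial_def prod_single monom_0)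

lemma prod_rees_var_image:
  "(\<Prod>z\<in>Poly_Mapping.keys m. rees_var_image z ^ Poly_Mapping.lookup m z) =
     monom (Poly_Mapping.single (fst (rees_degree m)) (1::'k::field)) (snd (rees_degree m))"
proof -
  have "(\<Prod>z\<in>S. rees_var_image z ^ k z) =
     monom (Poly_Mapping.single (\<Sum>z\<in>S. \<Sum>i<k z. vertex_weight z) (1::'k)) (\<Sum>z\<in>S. t_weight z * k z)"
    if "finite S" for S and k :: "'a rees_var \<Rightarrow> nat"
    using that
    by induction
      (simp_all add: rees_var_image_eq_monom monom_power single_power mult_monom mult_single monom_0)
  then show ?thesis by (simp add: rees_degree_def)
qed

lemma rees_map_superset:
  assumes "finite S" "Poly_Mapping.keys p \<subseteq> S"
  shows "rees_map (p :: ('v rees_var, 'k::field) mpoly) =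
    (\<Sum>m\<in>S. monom (Poly_Mapping.single (fst (rees_degree m)) (Poly_Mapping.lookup p m)) (snd (rees_degree m)))"
proof -
  have "rees_map p = (\<Sum>m\<in>Poly_Mapping.keys p.
    monom (Poly_Mapping.single (fst (rees_degree m)) (Poly_Mapping.lookup p m)) (snd (rees_degree m)))"
    unfolding rees_map_def prod_rees_var_image
    by (intro sum.cong) (auto simp: Const_def smult_monom mult_single)
  also have "\<dots> = (\<Sum>m\<in>S.
    monom (Poly_Mapping.single (fst (rees_degree m)) (Poly_Mapping.lookup p m)) (snd (rees_degree m)))"
    using assms by (intro sum.mono_neutral_left) (auto simp: in_keys_iff)
  finally show ?thesis .
qed

lemma rees_map_diff: "rees_map (p - q) = rees_map p - rees_map (q :: ('v rees_var, 'k::field) mpoly)"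
proof -
  let ?S = "Poly_Mapping.keys p \<union> Poly_Mapping.keys q"
  have "Poly_Mapping.keys (p - q) \<subseteq> ?S"
    by (auto simp: in_keys_iff lookup_minus)
  then show ?thesis
    using rees_map_superset[of ?S p] rees_map_superset[of ?S q] rees_map_superset[of ?S "p - q"]
    by (simp add: lookup_minus single_diff sum_subtractf flip: diff_monom)
qed

lemma rees_map_single:
  "rees_map (Poly_Mapping.single m (1::'k::field)) =
     monom (Poly_Mapping.single (fst (rees_degree m)) 1) (snd (rees_degree m))"
  using rees_map_superset[of "{m}" "Poly_Mapping.single m (1::'k)"] by simp

lemma lookup_coeff_rees_map:
  "Poly_Mapping.lookup (coeff (rees_map p) n) a =
     (\<Sum>m\<in>Poly_Mapping.keys p. if rees_degree m = (a, n) then Poly_Mapping.lookup p m else 0)"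
  by (auto simp: rees_map_superset[OF finite_keys subset_refl] coeff_sum lookup_sum lookup_single when_def
      prod_eq_iff intro!: sum.cong)

lemma rees_degree_superset:
  assumes "finite W" "Poly_Mapping.keys m \<subseteq> W"
  shows "rees_degree m = (\<Sum>z\<in>W. \<Sum>i<Poly_Mapping.lookup m z. vertex_weight z,
      \<Sum>z\<in>W. t_weight z * Poly_Mapping.lookup m z)"
  unfolding rees_degree_def prod_eq_iff fst_conv snd_conv
  by (intro conjI sum.mono_neutral_left) (use assms in \<open>auto simp: in_keys_iff\<close>)

lemma rees_degree_add:
  "rees_degree (a + b) = (fst (rees_degree a) + fst (rees_degree b), snd (rees_degree a) + snd (rees_degree b))"
proof -
  let ?W = "Poly_Mapping.keys a \<union> Poly_Mapping.keys b"
  have "(\<Sum>i<k + l. w) = (\<Sum>i<k. w) + (\<Sum>i<l. w)" for k l :: nat and w :: "'a monomial"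
    by (induction l) (simp_all add: add.assoc)
  then show ?thesis
    using rees_degree_superset[of ?W a] rees_degree_superset[of ?W b]
      rees_degree_superset[of ?W "a + b"] Poly_Mapping.keys_add[of a b]
    by (simp add: lookup_add sum.distrib distrib_left)
qed

lemma defining_ideal_iff:
  "f \<in> defining_ideal X Y E \<longleftrightarrow> Poly_Mapping.keys f \<subseteq> monomials (rees_vars X Y E) \<and> rees_map f = 0"
  by (simp add: defining_ideal_def a_kernel_def' poly_ring_def rees_algebra_def ring_on_def)

text \<open>The coefficient of \<open>m\<close> cannot cancel in the image of \<open>f\<close> against coefficients from other
  fibres.\<close>

lemma defining_ideal_fibre:
  assumes "f \<in> defining_ideal X Y E" "m \<in> Poly_Mapping.keys f"
  shows "\<exists>m'\<in>Poly_Mapping.keys f. m' \<noteq> m \<and> rees_degree m' = rees_degree m"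
proof (rule ccontr)
  assume no: "\<not> ?thesis"
  have "0 = Poly_Mapping.lookup (coeff (rees_map f) (snd (rees_degree m))) (fst (rees_degree m))"
    using assms by (simp add: defining_ideal_iff)
  also have "\<dots> = (\<Sum>m'\<in>Poly_Mapping.keys f. if m' = m then Poly_Mapping.lookup f m' else 0)"
    unfolding lookup_coeff_rees_map by (intro sum.cong) (use no in auto)
  also have "\<dots> = Poly_Mapping.lookup f m"
    using assms(2) by simp
  finally show False
    using assms(2) by (simp add: in_keys_iff)
qed

lemma defining_ideal_binomial:
  assumes "m \<in> monomials (rees_vars X Y E)" "m' \<in> monomials (rees_vars X Y E)" "rees_degree m = rees_degree m'"
  shows "Poly_Mapping.single m (1::'k::field) - Poly_Mapping.single m' 1 \<in> defining_ideal X Y E"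
proof -
  have "Poly_Mapping.keys (Poly_Mapping.single m (1::'k) - Poly_Mapping.single m' 1) \<subseteq> {m, m'}"
    using keys_binomial[of m m', where 'k = 'k] by (cases "m = m'") simp_all
  then show ?thesis
    using assms by (auto simp: defining_ideal_iff rees_map_diff rees_map_single)
qed

lemma defining_ideal_diff:
  assumes "f \<in> defining_ideal X Y E" "g \<in> defining_ideal X Y E"
  shows "f - g \<in> defining_ideal X Y E"
proof -
  have "Poly_Mapping.keys (f - g) \<subseteq> Poly_Mapping.keys f \<union> Poly_Mapping.keys g"
    by (auto simp: in_keys_iff lookup_minus)
  then show ?thesis
    using assms by (auto simp: defining_ideal_iff rees_map_diff)
qed


section \<open>The Rees variables as edges of an extended bipartite graph\<close>

text \<open>Both sides get one further vertex \<open>None\<close>. A vertex of \<open>G\<close> is read as the edge that joins it to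
  the new vertex of the other side; an edge of \<open>G\<close> stays an edge.\<close>

definition arcs :: "'v set \<Rightarrow> 'v set \<Rightarrow> 'v set set \<Rightarrow> ('v option \<times> 'v option) set" where
  "arcs X Y E = {(Some x, Some y) | x y. x \<in> X \<and> y \<in> Y \<and> {x, y} \<in> E} \<union>
     {(Some x, None) | x. x \<in> X} \<union> {(None, Some y) | y. y \<in> Y}"

fun arc_var :: "'v option \<times> 'v option \<Rightarrow> 'v rees_var" where
  "arc_var (Some x, Some y) = Edge {x, y}"
| "arc_var (Some x, None) = Vert x"
| "arc_var (None, Some y) = Vert y"
| "arc_var (None, None) = undefined"

definition arc_product :: "('v option \<times> 'v option) list \<Rightarrow> 'v rees_var monomial" where
  "arc_product es = (\<Sum>e\<leftarrow>es. Poly_Mapping.single (arc_var e) 1)"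

lemma keys_add_nat:
  "Poly_Mapping.keys (a + b) = Poly_Mapping.keys a \<union> Poly_Mapping.keys (b :: 'z monomial)"
  by (auto simp: in_keys_iff lookup_add)

lemma keys_arc_product: "Poly_Mapping.keys (arc_product es) = arc_var ` set es"
  by (induction es) (simp_all add: arc_product_def keys_add_nat)

locale bipartite =
  fixes X Y :: "'v set" and E :: "'v set set"
  assumes bipartite: "bipartite_graph X Y E"
begin

abbreviation "A \<equiv> arcs X Y E"
abbreviation "V \<equiv> rees_vars X Y E"

lemma finite_X: "finite X" and finite_Y: "finite Y" and disjoint: "X \<inter> Y = {}"
  and E_sub: "E \<subseteq> {{x, y} | x y. x \<in> X \<and> y \<in> Y}"
  using bipartite by (auto simp: bipartite_graph_def)

lemma finite_A: "finite A"
proof -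
  have "A \<subseteq> insert None (Some ` X) \<times> insert None (Some ` Y)"
    by (auto simp: arcs_def)
  then show ?thesis
    using finite_X finite_Y finite_subset by blast
qed

lemma inj_arc_var: "inj_on arc_var A"
  using disjoint by (auto simp: inj_on_def arcs_def doubleton_eq_iff)

lemma arc_var_image: "arc_var ` A = V"
proof
  show "arc_var ` A \<subseteq> V"
    by (auto simp: arcs_def rees_vars_def)
  show "V \<subseteq> arc_var ` A"
  proof
    fix z assume "z \<in> V"
    then consider x where "z = Vert x" "x \<in> X" | y where "z = Vert y" "y \<in> Y"
      | x y where "z = Edge {x, y}" "x \<in> X" "y \<in> Y" "{x, y} \<in> E"
      using E_sub by (auto simp: rees_vars_def)
    then show "z \<in> arc_var ` A"
    proof cases
      case (1 x) then show ?thesis by (intro image_eqI[of _ _ "(Some x, None)"]) (auto simp: arcs_def)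
    next
      case (2 y) then show ?thesis by (intro image_eqI[of _ _ "(None, Some y)"]) (auto simp: arcs_def)
    next
      case (3 x y) then show ?thesis by (intro image_eqI[of _ _ "(Some x, Some y)"]) (auto simp: arcs_def)
    qed
  qed
qed

lemma finite_V: "finite V"
  using finite_A arc_var_image by (metis finite_imageI)

lemma sum_V: "(\<Sum>z\<in>V. g z) = (\<Sum>e\<in>A. g (arc_var e))"
  unfolding arc_var_image[symmetric] using inj_arc_var by (simp add: sum.reindex)

definition left_sum :: "'v rees_var monomial \<Rightarrow> 'v option \<Rightarrow> nat" where
  "left_sum m x = (\<Sum>e | e \<in> A \<and> fst e = x. Poly_Mapping.lookup m (arc_var e))"

definition right_sum :: "'v rees_var monomial \<Rightarrow> 'v option \<Rightarrow> nat" where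
  "right_sum m y = (\<Sum>e | e \<in> A \<and> snd e = y. Poly_Mapping.lookup m (arc_var e))"

lemma left_sum_if: "left_sum m x = (\<Sum>e\<in>A. if fst e = x then Poly_Mapping.lookup m (arc_var e) else 0)"
  unfolding left_sum_def using sum.inter_filter[OF finite_A] by simp

lemma right_sum_if: "right_sum m y = (\<Sum>e\<in>A. if snd e = y then Poly_Mapping.lookup m (arc_var e) else 0)"
  unfolding right_sum_def using sum.inter_filter[OF finite_A] by simp

lemma lookup_vertex_weight:
  assumes "e \<in> A"
  shows "x \<in> X \<Longrightarrow> Poly_Mapping.lookup (vertex_weight (arc_var e)) x = (if fst e = Some x then 1 else 0)"
    and "y \<in> Y \<Longrightarrow> Poly_Mapping.lookup (vertex_weight (arc_var e)) y = (if snd e = Some y then 1 else 0)"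
    and "v \<notin> X \<union> Y \<Longrightarrow> Poly_Mapping.lookup (vertex_weight (arc_var e)) v = 0"
proof -
  have neq: "x \<noteq> y" if "x \<in> X" "y \<in> Y" for x y
    using disjoint that by blast
  have "vertex_weight (Edge {x, y}) = Poly_Mapping.single x 1 + Poly_Mapping.single y 1"
    if "x \<in> X" "y \<in> Y" for x y
    using neq[OF that] by simp
  then show "x \<in> X \<Longrightarrow> Poly_Mapping.lookup (vertex_weight (arc_var e)) x = (if fst e = Some x then 1 else 0)"
    and "y \<in> Y \<Longrightarrow> Poly_Mapping.lookup (vertex_weight (arc_var e)) y = (if snd e = Some y then 1 else 0)"
    and "v \<notin> X \<union> Y \<Longrightarrow> Poly_Mapping.lookup (vertex_weight (arc_var e)) v = 0"
    using assms disjoint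
    by (auto simp: arcs_def lookup_single when_def lookup_add simp del: vertex_weight.simps(2))
qed

lemma lookup_fst_rees_degree:
  assumes "m \<in> monomials V"
  shows "Poly_Mapping.lookup (fst (rees_degree m)) v =
    (\<Sum>e\<in>A. Poly_Mapping.lookup m (arc_var e) * Poly_Mapping.lookup (vertex_weight (arc_var e)) v)"
  using assms rees_degree_superset[OF finite_V, of m]
  by (simp add: monomials_def lookup_sum sum_V)

lemma lookup_fst_rees_degree_X:
  "m \<in> monomials V \<Longrightarrow> x \<in> X \<Longrightarrow> Poly_Mapping.lookup (fst (rees_degree m)) x = left_sum m (Some x)"
  unfolding lookup_fst_rees_degree left_sum_if by (intro sum.cong) (auto simp: lookup_vertex_weight)

lemma lookup_fst_rees_degree_Y:
  "m \<in> monomials V \<Longrightarrow> y \<in> Y \<Longrightarrow> Poly_Mapping.lookup (fst (rees_degree m)) y = right_sum m (Some y)"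
  unfolding lookup_fst_rees_degree right_sum_if by (intro sum.cong) (auto simp: lookup_vertex_weight)

lemma lookup_fst_rees_degree_other:
  "m \<in> monomials V \<Longrightarrow> v \<notin> X \<union> Y \<Longrightarrow> Poly_Mapping.lookup (fst (rees_degree m)) v = 0"
  unfolding lookup_fst_rees_degree by (simp add: lookup_vertex_weight)

lemma snd_rees_degree:
  "m \<in> monomials V \<Longrightarrow> snd (rees_degree m) =
     (\<Sum>e\<in>A. if fst e \<noteq> None \<and> snd e \<noteq> None then Poly_Mapping.lookup m (arc_var e) else 0)"
  using rees_degree_superset[OF finite_V, of m]
  by (auto simp: monomials_def sum_V arcs_def intro!: sum.cong)

text \<open>Summing over the vertices of one side of \<open>G\<close> counts the edges of \<open>G\<close>, whose number is the
  exponent of \<open>t\<close>, and the edges to the additional vertex opposite.\<close>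

lemma snd_rees_degree_left:
  assumes "m \<in> monomials V"
  shows "snd (rees_degree m) + left_sum m None = (\<Sum>y\<in>Y. right_sum m (Some y))"
proof -
  have "(\<Sum>y\<in>Y. right_sum m (Some y)) =
      (\<Sum>e\<in>A. \<Sum>y\<in>Y. if snd e = Some y then Poly_Mapping.lookup m (arc_var e) else 0)"
    unfolding right_sum_if by (rule sum.swap)
  also have "\<dots> = (\<Sum>e\<in>A. (if fst e \<noteq> None \<and> snd e \<noteq> None then Poly_Mapping.lookup m (arc_var e) else 0)
      + (if fst e = None then Poly_Mapping.lookup m (arc_var e) else 0))"
    using finite_Y by (intro sum.cong) (auto simp: arcs_def)
  finally show ?thesis
    using assms by (simp add: snd_rees_degree left_sum_if sum.distrib)
qed

lemma snd_rees_degree_right: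
  assumes "m \<in> monomials V"
  shows "snd (rees_degree m) + right_sum m None = (\<Sum>x\<in>X. left_sum m (Some x))"
proof -
  have "(\<Sum>x\<in>X. left_sum m (Some x)) =
      (\<Sum>e\<in>A. \<Sum>x\<in>X. if fst e = Some x then Poly_Mapping.lookup m (arc_var e) else 0)"
    unfolding left_sum_if by (rule sum.swap)
  also have "\<dots> = (\<Sum>e\<in>A. (if fst e \<noteq> None \<and> snd e \<noteq> None then Poly_Mapping.lookup m (arc_var e) else 0)
      + (if snd e = None then Poly_Mapping.lookup m (arc_var e) else 0))"
    using finite_X by (intro sum.cong) (auto simp: arcs_def)
  finally show ?thesis
    using assms by (simp add: snd_rees_degree right_sum_if sum.distrib)
qed

lemma sum_outside:
  "x \<notin> X \<Longrightarrow> left_sum m (Some x) = 0" "y \<notin> Y \<Longrightarrow> right_sum m (Some y) = 0"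
  unfolding left_sum_if right_sum_if by (auto simp: arcs_def intro!: sum.neutral)

text \<open>The image records the sums at the vertices of \<open>G\<close> and the exponent of \<open>t\<close>. The latter is
  interchangeable with the sum at either additional vertex, by the two identities above.\<close>

lemma same_degree_iff:
  assumes ab: "a \<in> monomials V" "b \<in> monomials V"
  shows "rees_degree a = rees_degree b \<longleftrightarrow>
    same_vertex_sums A (\<lambda>e. Poly_Mapping.lookup a (arc_var e)) (\<lambda>e. Poly_Mapping.lookup b (arc_var e))"
proof -
  have "rees_degree a = rees_degree b \<longleftrightarrow>
    (\<forall>x. left_sum a x = left_sum b x) \<and> (\<forall>y. right_sum a y = right_sum b y)"
  proof
    assume eq: "rees_degree a = rees_degree b"
    have l: "left_sum a (Some x) = left_sum b (Some x)" for x
      using eq lookup_fst_rees_degree_X[OF ab(1), of x] lookup_fst_rees_degree_X[OF ab(2), of x]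
      by (cases "x \<in> X") (simp_all add: sum_outside)
    have r: "right_sum a (Some y) = right_sum b (Some y)" for y
      using eq lookup_fst_rees_degree_Y[OF ab(1), of y] lookup_fst_rees_degree_Y[OF ab(2), of y]
      by (cases "y \<in> Y") (simp_all add: sum_outside)
    have "left_sum a None = left_sum b None" "right_sum a None = right_sum b None"
      using snd_rees_degree_left[OF ab(1)] snd_rees_degree_left[OF ab(2)]
        snd_rees_degree_right[OF ab(1)] snd_rees_degree_right[OF ab(2)] eq l r by simp_all
    then show "(\<forall>x. left_sum a x = left_sum b x) \<and> (\<forall>y. right_sum a y = right_sum b y)"
      using l r by (metis option.exhaust)
  next
    assume eq: "(\<forall>x. left_sum a x = left_sum b x) \<and> (\<forall>y. right_sum a y = right_sum b y)"
    have "fst (rees_degree a) = fst (rees_degree b)"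
    proof (rule poly_mapping_eqI)
      fix v show "Poly_Mapping.lookup (fst (rees_degree a)) v = Poly_Mapping.lookup (fst (rees_degree b)) v"
        using ab eq
        by (cases "v \<in> X"; cases "v \<in> Y")
          (simp_all add: lookup_fst_rees_degree_X lookup_fst_rees_degree_Y lookup_fst_rees_degree_other)
    qed
    moreover have "snd (rees_degree a) = snd (rees_degree b)"
      using snd_rees_degree_left[OF ab(1)] snd_rees_degree_left[OF ab(2)] eq by simp
    ultimately show "rees_degree a = rees_degree b"
      by (rule prod_eqI)
  qed
  then show ?thesis
    by (simp add: left_sum_def right_sum_def same_vertex_sums_def)
qed

lemma lookup_arc_product:
  assumes "set es \<subseteq> A" "e \<in> A"
  shows "Poly_Mapping.lookup (arc_product es) (arc_var e) = count_list es e"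
  using assms
proof (induction es)
  case (Cons a es)
  then have "arc_var a = arc_var e \<longleftrightarrow> a = e"
    using inj_arc_var by (auto simp: inj_on_def)
  then show ?case
    using Cons by (auto simp: arc_product_def lookup_add lookup_single when_def)
qed (simp add: arc_product_def)

lemma arc_product_monomials: "set es \<subseteq> A \<Longrightarrow> arc_product es \<in> monomials V"
  using arc_var_image by (auto simp: monomials_def keys_arc_product)

lemma mon_dvd_arc_product:
  assumes "set es \<subseteq> A" "distinct es" "\<And>e. e \<in> set es \<Longrightarrow> 0 < Poly_Mapping.lookup m (arc_var e)"
  shows "mon_dvd (arc_product es) m"
  unfolding mon_dvd_iff_lookup_le
proof
  fix z show "Poly_Mapping.lookup (arc_product es) z \<le> Poly_Mapping.lookup m z"
  proof (cases "z \<in> Poly_Mapping.keys (arc_product es)")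
    case True
    then obtain e where e: "e \<in> set es" "z = arc_var e"
      by (auto simp: keys_arc_product)
    then have "Poly_Mapping.lookup (arc_product es) z = count_list es e"
      using lookup_arc_product assms(1) by blast
    also have "\<dots> = 1"
      using distinct_count_atmost_1[THEN iffD1, OF assms(2), THEN spec, of e] e(1) by (simp add: count_mset)
    finally show ?thesis
      using assms(3)[OF e(1)] e(2) by simp
  qed (simp add: in_keys_iff)
qed

lemma sum_count_list:
  "finite S \<Longrightarrow> set es \<subseteq> S \<Longrightarrow> (\<Sum>e | e \<in> S \<and> g e = x. count_list es e) = count_list (map g es) x"
proof (induction es)
  case (Cons a es)
  have "(\<Sum>e | e \<in> S \<and> g e = x. count_list (a # es) e) =
      (\<Sum>e | e \<in> S \<and> g e = x. (if e = a then 1 else 0) + count_list es e)"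
    by (intro sum.cong) auto
  also have "\<dots> = (if g a = x then 1 else 0) + count_list (map g es) x"
    using Cons by (simp add: sum.distrib)
  finally show ?case by simp
qed simp

text \<open>Both alternating edge sets of a cycle meet each vertex of the cycle once.\<close>

lemma alt_cycle_same_degree:
  assumes "alt_cycle A xs ys"
  shows "rees_degree (arc_product (zip xs ys)) = rees_degree (arc_product (zip (rotate1 xs) ys))"
proof -
  have len: "length xs = length ys" and sub: "set (zip xs ys) \<subseteq> A" "set (zip (rotate1 xs) ys) \<subseteq> A"
    using assms by (auto simp: alt_cycle_def)
  have sum: "(\<Sum>e | e \<in> A \<and> g e = x. Poly_Mapping.lookup (arc_product es) (arc_var e)) = count_list (map g es) x"
    if "set es \<subseteq> A" for es x and g :: "'v option \<times> 'v option \<Rightarrow> 'v option"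
    using sum_count_list[OF finite_A that, of g x] lookup_arc_product[OF that] by simp
  have "count_list (rotate1 xs) x = count_list xs x" for x
    by (cases xs) simp_all
  then have "same_vertex_sums A (\<lambda>e. Poly_Mapping.lookup (arc_product (zip xs ys)) (arc_var e))
     (\<lambda>e. Poly_Mapping.lookup (arc_product (zip (rotate1 xs) ys)) (arc_var e))"
    unfolding same_vertex_sums_def using sum[OF sub(1)] sum[OF sub(2)] len by simp
  then show ?thesis
    using same_degree_iff[OF arc_product_monomials[OF sub(1)] arc_product_monomials[OF sub(2)]] by simp
qed

definition circuits :: "('v rees_var monomial \<times> 'v rees_var monomial) set" where
  "circuits = {(arc_product (zip xs ys), arc_product (zip (rotate1 xs) ys)) | xs ys. alt_cycle A xs ys}"

lemma finite_circuits: "finite circuits"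
proof -
  let ?L = "{xs. set xs \<subseteq> fst ` A \<and> distinct xs} \<times> {ys. set ys \<subseteq> snd ` A \<and> distinct ys}"
  have "(xs, ys) \<in> ?L" if "alt_cycle A xs ys" for xs ys
  proof -
    have "set xs = fst ` set (zip xs ys)" "set ys = snd ` set (zip xs ys)"
      using that by (simp_all add: alt_cycle_def flip: set_map)
    then show ?thesis
      using that by (auto simp: alt_cycle_def simp del: set_zip)
  qed
  then have "circuits \<subseteq> (\<lambda>(xs, ys). (arc_product (zip xs ys), arc_product (zip (rotate1 xs) ys))) ` ?L"
    unfolding circuits_def by fast
  moreover have "finite ?L"
    using finite_A by (intro finite_cartesian_product finite_subset_distinct finite_imageI)
  ultimately show ?thesis
    using finite_surj by blast
qed

lemma finite_bounded_monomials:
  assumes "finite W"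
  shows "finite {m \<in> monomials W. \<forall>z\<in>W. Poly_Mapping.lookup m z \<le> (N::nat)}" (is "finite ?M")
proof (rule finite_imageD)
  have "Poly_Mapping.lookup ` ?M \<subseteq> {f. \<forall>z. (z \<in> W \<longrightarrow> f z \<in> {..N}) \<and> (z \<notin> W \<longrightarrow> f z = 0)}"
    by (auto simp: monomials_def in_keys_iff subset_iff)
  then show "finite (Poly_Mapping.lookup ` ?M)"
    using finite_set_of_finite_funs[OF assms, of "{..N}" 0] finite_subset by blast
  show "inj_on Poly_Mapping.lookup ?M"
    by (rule inj_onI) (simp only: poly_mapping.lookup_inject)
qed

text \<open>Every edge of the extended graph has an end in \<open>G\<close>, whose vertex sum is an exponent of the image
  and bounds the multiplicity of the edge.\<close>

lemma finite_rees_fibre: "finite {m \<in> monomials V. rees_degree m = d}"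
proof -
  let ?N = "\<Sum>v\<in>X \<union> Y. Poly_Mapping.lookup (fst d) v"
  have "Poly_Mapping.lookup m z \<le> ?N" if m: "m \<in> monomials V" "rees_degree m = d" and "z \<in> V" for m z
  proof -
    obtain e where e: "e \<in> A" "z = arc_var e"
      using \<open>z \<in> V\<close> arc_var_image by blast
    have fin: "finite (X \<union> Y)" using finite_X finite_Y by simp
    have l: "Poly_Mapping.lookup m z \<le> left_sum m (fst e)" and r: "Poly_Mapping.lookup m z \<le> right_sum m (snd e)"
      unfolding left_sum_def right_sum_def e(2) using finite_A e(1) by (auto intro!: member_le_sum)
    have "\<exists>v\<in>X \<union> Y. Poly_Mapping.lookup m z \<le> Poly_Mapping.lookup (fst d) v"
      using e(1) l r m lookup_fst_rees_degree_X[OF m(1)] lookup_fst_rees_degree_Y[OF m(1)]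
      by (force simp: arcs_def)
    then show ?thesis
      using member_le_sum[OF _ _ fin, of _ "Poly_Mapping.lookup (fst d)"] by (meson le_trans zero_le)
  qed
  then have "{m \<in> monomials V. rees_degree m = d} \<subseteq> {m \<in> monomials V. \<forall>z\<in>V. Poly_Mapping.lookup m z \<le> ?N}"
    by blast
  then show ?thesis
    using finite_bounded_monomials[OF finite_V] finite_subset by blast
qed

lemma alt_cycle_mon_dvd:
  assumes "alt_cycle A xs ys" "\<And>e. e \<in> set (zip xs ys) \<Longrightarrow> n e < Poly_Mapping.lookup m (arc_var e)"
  shows "mon_dvd (arc_product (zip xs ys)) m"
proof (rule mon_dvd_arc_product)
  show "set (zip xs ys) \<subseteq> A" "distinct (zip xs ys)"
    using assms(1) by (simp_all add: alt_cycle_def distinct_zipI1)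
  show "0 < Poly_Mapping.lookup m (arc_var e)" if "e \<in> set (zip xs ys)" for e
    using assms(2)[OF that] by (rule le_less_trans[OF le0])
qed

lemma alt_cycle_mon_dvd_rotate:
  assumes "alt_cycle A xs ys" "\<And>e. e \<in> set (zip (rotate1 xs) ys) \<Longrightarrow> n e < Poly_Mapping.lookup m (arc_var e)"
  shows "mon_dvd (arc_product (zip (rotate1 xs) ys)) m"
proof (rule mon_dvd_arc_product)
  show "set (zip (rotate1 xs) ys) \<subseteq> A" "distinct (zip (rotate1 xs) ys)"
    using assms(1) by (simp_all add: alt_cycle_def distinct_zipI1)
  show "0 < Poly_Mapping.lookup m (arc_var e)" if "e \<in> set (zip (rotate1 xs) ys)" for e
    using assms(2)[OF that] by (rule le_less_trans[OF le0])
qed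

lemma monomials_neq_arc:
  assumes "a \<in> monomials V" "b \<in> monomials V" "a \<noteq> b"
  shows "\<exists>e\<in>A. Poly_Mapping.lookup a (arc_var e) \<noteq> Poly_Mapping.lookup b (arc_var e)"
proof -
  obtain z where z: "Poly_Mapping.lookup a z \<noteq> Poly_Mapping.lookup b z"
    using assms(3) by (meson poly_mapping_eqI)
  then have "z \<in> Poly_Mapping.keys a \<union> Poly_Mapping.keys b"
    by (simp add: in_keys_iff) linarith
  then have "z \<in> V"
    using assms(1,2) by (auto simp: monomials_def)
  then obtain e where "e \<in> A" "z = arc_var e"
    using arc_var_image by blast
  then show ?thesis
    using z by blast
qed

lemma toric_circuits_defining_ideal:
  "toric_circuits V (defining_ideal X Y E :: ('v rees_var, 'k::field) mpoly set) rees_degree circuits"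
proof
  show "finite V" by (rule finite_V)
  show "finite circuits" by (rule finite_circuits)
  show "finite {m \<in> monomials V. rees_degree m = d}" for d by (rule finite_rees_fibre)
  show "Poly_Mapping.keys f \<subseteq> monomials V" if "f \<in> defining_ideal X Y E" for f :: "('v rees_var, 'k) mpoly"
    using that by (simp add: defining_ideal_iff)
  show "\<exists>m'\<in>Poly_Mapping.keys f. m' \<noteq> m \<and> rees_degree m' = rees_degree m"
    if "f \<in> defining_ideal X Y E" "m \<in> Poly_Mapping.keys f" for f :: "('v rees_var, 'k) mpoly" and m
    using that by (rule defining_ideal_fibre)
  show "Poly_Mapping.single m 1 - Poly_Mapping.single m' 1 \<in> (defining_ideal X Y E :: ('v rees_var, 'k) mpoly set)"
    if "m \<in> monomials V" "m' \<in> monomials V" "rees_degree m = rees_degree m'" for m m'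
    using that by (rule defining_ideal_binomial)
  show "f - g \<in> defining_ideal X Y E" if "f \<in> defining_ideal X Y E" "g \<in> defining_ideal X Y E"
    for f g :: "('v rees_var, 'k) mpoly"
    using that by (rule defining_ideal_diff)
  show "rees_degree (m + u) = rees_degree (m' + u)" if "rees_degree m = rees_degree m'" for m m' u :: "'v rees_var monomial"
    using that by (simp add: rees_degree_add)
next
  fix p q assume "(p, q) \<in> circuits"
  then obtain xs ys where cyc: "alt_cycle A xs ys"
    and pq: "p = arc_product (zip xs ys)" "q = arc_product (zip (rotate1 xs) ys)"
    by (auto simp: circuits_def)
  have sub: "set (zip xs ys) \<subseteq> A" "set (zip (rotate1 xs) ys) \<subseteq> A"
    using cyc by (auto simp: alt_cycle_def)
  have ne: "zip xs ys \<noteq> []" "zip (rotate1 xs) ys \<noteq> []"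
    using cyc by (auto simp: alt_cycle_def zip_eq_Nil_iff)
  have keys: "Poly_Mapping.keys p = arc_var ` set (zip xs ys)"
      "Poly_Mapping.keys q = arc_var ` set (zip (rotate1 xs) ys)"
    unfolding pq keys_arc_product by simp_all
  have "Poly_Mapping.keys p \<noteq> {}" "Poly_Mapping.keys q \<noteq> {}"
    unfolding keys image_is_empty set_empty by (rule ne)+
  moreover have "Poly_Mapping.keys p \<inter> Poly_Mapping.keys q = {}"
    unfolding keys inj_on_image_Int[OF inj_arc_var sub, symmetric] alt_cycle_zip_disjoint[OF cyc] by simp
  ultimately show "p \<in> monomials V \<and> q \<in> monomials V \<and> rees_degree p = rees_degree q \<and> p \<noteq> 0 \<and> q \<noteq> 0 \<and>
      Poly_Mapping.keys p \<inter> Poly_Mapping.keys q = {}"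
    using arc_product_monomials[OF sub(1)] arc_product_monomials[OF sub(2)] alt_cycle_same_degree[OF cyc]
    unfolding pq by auto
  fix m m' :: "'v rees_var monomial"
  assume neq: "m \<noteq> m'" and deg: "rees_degree m = rees_degree m'"
    and supp: "Poly_Mapping.keys m \<union> Poly_Mapping.keys m' \<subseteq> Poly_Mapping.keys p \<union> Poly_Mapping.keys q"
  have "arc_var ` set (zip xs ys) \<union> arc_var ` set (zip (rotate1 xs) ys) \<subseteq> V"
    using image_mono[OF sub(1), of arc_var] image_mono[OF sub(2), of arc_var] arc_var_image by blast
  then have mon: "m \<in> monomials V" "m' \<in> monomials V"
    using supp unfolding keys monomials_def by blast+
  obtain e where e: "e \<in> A" "Poly_Mapping.lookup m (arc_var e) \<noteq> Poly_Mapping.lookup m' (arc_var e)"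
    using monomials_neq_arc[OF mon neq] by blast
  have off: "Poly_Mapping.lookup m (arc_var e) = Poly_Mapping.lookup m' (arc_var e)"
    if "e \<in> A" "e \<notin> set (zip xs ys)" "e \<notin> set (zip (rotate1 xs) ys)" for e
  proof -
    have "arc_var e \<notin> Poly_Mapping.keys p \<union> Poly_Mapping.keys q"
      unfolding keys using that inj_on_image_mem_iff[OF inj_arc_var _ sub(1)]
        inj_on_image_mem_iff[OF inj_arc_var _ sub(2)] by blast
    then have "arc_var e \<notin> Poly_Mapping.keys m" "arc_var e \<notin> Poly_Mapping.keys m'"
      using supp by auto
    then show ?thesis by (simp add: in_keys_iff)
  qed
  let ?l = "\<lambda>m e. Poly_Mapping.lookup m (arc_var e)"
  have "(\<forall>e\<in>set (zip xs ys). ?l m' e < ?l m e) \<and> (\<forall>e\<in>set (zip (rotate1 xs) ys). ?l m e < ?l m' e) \<or>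
        (\<forall>e\<in>set (zip xs ys). ?l m e < ?l m' e) \<and> (\<forall>e\<in>set (zip (rotate1 xs) ys). ?l m' e < ?l m e)"
    using same_degree_iff[OF mon] deg finite_A cyc e off
    by (intro alt_cycle_rigid[where \<alpha> = "?l m" and \<beta> = "?l m'" and A = A and e = e]) simp_all
  moreover have "mon_dvd p a" if "\<forall>e\<in>set (zip xs ys). ?l b e < ?l a e" for a b
    unfolding pq using that by (intro alt_cycle_mon_dvd[OF cyc]) blast
  moreover have "mon_dvd q a" if "\<forall>e\<in>set (zip (rotate1 xs) ys). ?l b e < ?l a e" for a b
    unfolding pq using that by (intro alt_cycle_mon_dvd_rotate[OF cyc]) blast
  ultimately show "mon_dvd p m \<and> mon_dvd q m' \<or> mon_dvd q m \<and> mon_dvd p m'"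
    by blast
next
  fix m m' :: "'v rees_var monomial"
  assume mon: "m \<in> monomials V" "m' \<in> monomials V" and deg: "rees_degree m = rees_degree m'" and neq: "m \<noteq> m'"
  obtain e where e: "e \<in> A" "Poly_Mapping.lookup m (arc_var e) \<noteq> Poly_Mapping.lookup m' (arc_var e)"
    using monomials_neq_arc[OF mon neq] by blast
  obtain xs ys where cyc: "alt_cycle A xs ys"
    and pos: "\<forall>e\<in>set (zip xs ys). Poly_Mapping.lookup m' (arc_var e) < Poly_Mapping.lookup m (arc_var e)"
    and neg: "\<forall>e\<in>set (zip (rotate1 xs) ys). Poly_Mapping.lookup m (arc_var e) < Poly_Mapping.lookup m' (arc_var e)"
    using exists_alt_cycle[OF finite_A same_degree_iff[OF mon, THEN iffD1, OF deg] e] by blast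
  have "mon_dvd (arc_product (zip xs ys)) m"
    using pos by (intro alt_cycle_mon_dvd[OF cyc]) blast
  moreover have "mon_dvd (arc_product (zip (rotate1 xs) ys)) m'"
    using neg by (intro alt_cycle_mon_dvd_rotate[OF cyc]) blast
  ultimately show "\<exists>p q. (p, q) \<in> circuits \<and> mon_dvd p m \<and> mon_dvd q m'"
    unfolding circuits_def using cyc by blast
qed

end


section \<open>Walks as pairs of vertex lists\<close>

text \<open>A walk alternates between the two sides of the graph, so it amounts to the list of its vertices
  on the side where it starts and the list on the other side. Pairing the two lists gives the edges
  in odd positions; pairing them after dropping the first vertex gives those in even positions.\<close>

fun evens :: "'a list \<Rightarrow> 'a list" and odds :: "'a list \<Rightarrow> 'a list" where
  "evens [] = []"
| "evens (u # w) = u # odds w"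
| "odds [] = []"
| "odds (u # w) = evens w"

lemma length_evens: "length (evens w) = Suc (length w) div 2"
  and length_odds: "length (odds w) = length w div 2"
  by (induction w) auto

lemma set_evens_odds: "set w = set (evens w) \<union> set (odds w)"
  by (induction w) auto

lemma distinct_evens_odds:
  "distinct w \<longleftrightarrow> distinct (evens w) \<and> distinct (odds w) \<and> set (evens w) \<inter> set (odds w) = {}"
proof (induction w)
  case (Cons u w)
  then show ?case using set_evens_odds[of w] by auto
qed simp

lemma hd_evens: "hd (evens w) = hd w" if "w \<noteq> []"
  using that by (cases w) auto

lemma last_evens: "odd (length w) \<Longrightarrow> last (evens w) = last w"
  and last_odds: "w \<noteq> [] \<Longrightarrow> even (length w) \<Longrightarrow> last (odds w) = last w"
proof (induction w)
  case (Cons u w)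
  {
    case 1
    then show ?case
      using Cons(2) length_odds[of w] by (cases w) auto
  next
    case 2
    then have "w \<noteq> []" by auto
    then show ?case
      using 2 Cons(1) by simp
  }
qed simp_all

lemma evens_odds_surj:
  assumes "length us = length vs \<or> length us = Suc (length vs)"
  shows "\<exists>w. evens w = us \<and> odds w = vs \<and> length w = length us + length vs"
  using assms
proof (induction "length us + length vs" arbitrary: us vs rule: less_induct)
  case less
  show ?case
  proof (cases us)
    case Nil
    then show ?thesis using less(2) by (intro exI[of _ "[]"]) auto
  next
    case (Cons u us')
    then obtain w where "evens w = vs \<and> odds w = us' \<and> length w = length vs + length us'"
      using less(1)[of vs us'] less(2) by auto
    then show ?thesis using Cons by (intro exI[of _ "u # w"]) auto
  qed
qed

definition walk_monomial :: "'v list \<Rightarrow> 'v list \<Rightarrow> 'v rees_var monomial" where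
  "walk_monomial us vs = (\<Sum>(u, v)\<leftarrow>zip us vs. Poly_Mapping.single (Edge {u, v}) 1)"

lemma walk_monomial_simps [simp]:
  "walk_monomial [] vs = 0" "walk_monomial us [] = 0"
  "walk_monomial (u # us) (v # vs) = Poly_Mapping.single (Edge {u, v}) 1 + walk_monomial us vs"
  by (simp_all add: walk_monomial_def)

lemma walk_monomial_commute: "walk_monomial us vs = walk_monomial vs us"
proof (induction us arbitrary: vs)
  case (Cons u us)
  then show ?case by (cases vs) (simp_all add: insert_commute)
qed simp

lemma T_plus_Cons: "T_plus (u # v # w) = T_minus (v # w)"
proof -
  have set: "{j \<in> {1..walk_length (u # v # w)}. even j} = Suc ` {j \<in> {1..walk_length (v # w)}. odd j}"
  proof (intro equalityI subsetI)
    fix j assume "j \<in> {j \<in> {1..walk_length (u # v # w)}. even j}"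
    then show "j \<in> Suc ` {j \<in> {1..walk_length (v # w)}. odd j}"
      by (cases j) (auto simp: walk_length_def intro!: imageI elim: oddE)
  qed (auto simp: walk_length_def)
  show ?thesis
    unfolding T_plus_def T_minus_def set by (subst prod.reindex) (auto intro!: prod.cong simp: nth_Cons' )
qed

lemma T_minus_Cons: "T_minus (u # v # w) = Var (Edge {u, v}) * T_plus (v # w)"
proof -
  have set: "{j \<in> {1..walk_length (u # v # w)}. odd j} = insert 1 (Suc ` {j \<in> {1..walk_length (v # w)}. even j})"
  proof (intro equalityI subsetI)
    fix j assume "j \<in> {j \<in> {1..walk_length (u # v # w)}. odd j}"
    then show "j \<in> insert 1 (Suc ` {j \<in> {1..walk_length (v # w)}. even j})"
      by (cases j) (auto simp: walk_length_def image_iff)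
  qed (auto simp: walk_length_def)
  let ?f = "\<lambda>j. Var (Edge {(u # v # w) ! (j - 1), (u # v # w) ! j})"
  let ?S = "{j \<in> {1..walk_length (v # w)}. even j}"
  have "prod ?f (insert 1 (Suc ` ?S)) = ?f 1 * prod ?f (Suc ` ?S)"
    by (rule prod.insert) auto
  also have "prod ?f (Suc ` ?S) = T_plus (v # w)"
    unfolding T_plus_def by (subst prod.reindex) (auto intro!: prod.cong simp: nth_Cons')
  finally show ?thesis
    unfolding T_minus_def set by simp
qed

lemma T_minus_eq: "T_minus w = Poly_Mapping.single (walk_monomial (evens w) (odds w)) (1::'k::field)"
  and T_plus_eq: "T_plus w = Poly_Mapping.single (walk_monomial (tl (evens w)) (odds w)) (1::'k::field)"
proof (induction w)
  case Nil
  {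
    case 1 show ?case by (simp add: T_minus_def walk_length_def)
  next
    case 2 show ?case by (simp add: T_plus_def walk_length_def)
  }
next
  case (Cons u w)
  {
    case 1
    show ?case
    proof (cases w)
      case (Cons v w')
      then show ?thesis
        using Cons.IH(2) by (simp add: T_minus_Cons Var_def mult_single walk_monomial_commute)
    qed (simp add: T_minus_def walk_length_def)
  next
    case 2
    show ?case
    proof (cases w)
      case (Cons v w')
      then show ?thesis
        using Cons.IH(1) by (simp add: T_plus_Cons walk_monomial_commute)
    qed (simp add: T_plus_def walk_length_def)
  }
qed

lemma zip_snoc_right: "length xs = Suc (length ys) \<Longrightarrow> zip xs (ys @ [b]) = zip xs ys @ [(last xs, b)]"
  by (induction xs ys rule: list_induct2') (auto simp: length_Suc_conv)

lemma zip_snoc_left: "length ys = Suc (length xs) \<Longrightarrow> zip (xs @ [a]) ys = zip xs ys @ [(a, last ys)]"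
  by (induction xs ys rule: list_induct2') (auto simp: length_Suc_conv)

lemma arc_product_simps [simp]:
  "arc_product [] = 0"
  "arc_product (e # es) = Poly_Mapping.single (arc_var e) 1 + arc_product es"
  "arc_product (es @ fs) = arc_product es + arc_product fs"
  by (simp_all add: arc_product_def)

lemma arc_product_zip_Some: "arc_product (zip (map Some us) (map Some vs)) = walk_monomial us vs"
  by (induction us vs rule: list_induct2') auto

lemma arc_product_rev: "arc_product (rev es) = arc_product es"
  by (induction es) (simp_all add: add.commute)

lemma arc_product_rotate: "arc_product (rotate n es) = arc_product es"
proof (induction n)
  case (Suc n)
  have "arc_product (rotate1 fs) = arc_product fs" for fs :: "('a option \<times> 'a option) list"
    by (cases fs) (simp_all add: add.commute)
  then show ?case using Suc by simp
qed simp

lemma rotate1_zip: "length xs = length ys \<Longrightarrow> rotate1 (zip xs ys) = zip (rotate1 xs) (rotate1 ys)"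
  by (cases xs; cases ys) auto

lemma rotate_zip: "length xs = length ys \<Longrightarrow> rotate n (zip xs ys) = zip (rotate n xs) (rotate n ys)"
  by (induction n) (simp_all add: rotate1_zip)

lemma alt_cycle_rotate:
  assumes "alt_cycle A xs ys"
  shows "alt_cycle A (rotate n xs) (rotate n ys)"
    and "arc_product (zip (rotate n xs) (rotate n ys)) = arc_product (zip xs ys)"
    and "arc_product (zip (rotate1 (rotate n xs)) (rotate n ys)) = arc_product (zip (rotate1 xs) ys)"
proof -
  have len: "length xs = length ys" using assms by (simp add: alt_cycle_def)
  have z: "zip (rotate n xs) (rotate n ys) = rotate n (zip xs ys)"
    "zip (rotate1 (rotate n xs)) (rotate n ys) = rotate n (zip (rotate1 xs) ys)"
    using len by (simp_all add: rotate_zip rotate1_rotate_swap)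
  show "alt_cycle A (rotate n xs) (rotate n ys)"
    using assms unfolding alt_cycle_def z by simp
  show "arc_product (zip (rotate n xs) (rotate n ys)) = arc_product (zip xs ys)"
    "arc_product (zip (rotate1 (rotate n xs)) (rotate n ys)) = arc_product (zip (rotate1 xs) ys)"
    unfolding z by (rule arc_product_rotate)+
qed

text \<open>Running through a cycle backwards exchanges its two alternating edge sets.\<close>

lemma alt_cycle_reverse:
  assumes "alt_cycle A xs ys"
  shows "alt_cycle A (rev (rotate1 xs)) (rev ys)"
    and "arc_product (zip (rev (rotate1 xs)) (rev ys)) = arc_product (zip (rotate1 xs) ys)"
    and "arc_product (zip (rotate1 (rev (rotate1 xs))) (rev ys)) = arc_product (zip xs ys)"
proof -
  have len: "length xs = length ys" using assms by (simp add: alt_cycle_def)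
  have rot: "rotate1 (rev (rotate1 xs)) = rev xs"
    by (cases xs) simp_all
  have z: "zip (rev (rotate1 xs)) (rev ys) = rev (zip (rotate1 xs) ys)"
    "zip (rev xs) (rev ys) = rev (zip xs ys)"
    using len by (simp_all add: zip_rev)
  show "alt_cycle A (rev (rotate1 xs)) (rev ys)"
    using assms unfolding alt_cycle_def rot z by simp
  show "arc_product (zip (rev (rotate1 xs)) (rev ys)) = arc_product (zip (rotate1 xs) ys)"
    "arc_product (zip (rotate1 (rev (rotate1 xs))) (rev ys)) = arc_product (zip xs ys)"
    unfolding rot z by (rule arc_product_rev)+
qed


section \<open>Cycles of the extended graph as cycles and paths of the graph\<close>

definition circuit_binomial :: "'v option list \<Rightarrow> 'v option list \<Rightarrow> ('v rees_var, 'k::field) mpoly" where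
  "circuit_binomial xs ys = Poly_Mapping.single (arc_product (zip xs ys)) 1 -
     Poly_Mapping.single (arc_product (zip (rotate1 xs) ys)) 1"

lemma circuit_binomial_rotate:
  "alt_cycle A xs ys \<Longrightarrow> circuit_binomial (rotate n xs) (rotate n ys) = circuit_binomial xs ys"
  by (simp add: circuit_binomial_def alt_cycle_rotate)

lemma circuit_binomial_reverse:
  "alt_cycle A xs ys \<Longrightarrow> circuit_binomial (rev (rotate1 xs)) (rev ys) = - circuit_binomial xs ys"
  by (simp add: circuit_binomial_def alt_cycle_reverse)

lemma rotate_to_first:
  assumes "x \<in> set xs"
  shows "\<exists>n l. rotate n xs = x # l"
proof -
  obtain l l' where "xs = l @ x # l'"
    using split_list[OF assms] by auto
  then have "rotate (length l) xs = x # l' @ l"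
    by (simp only: rotate_append append_Cons)
  then show ?thesis by blast
qed

lemma rotate_to_last:
  assumes "x \<in> set xs"
  shows "\<exists>n l. rotate n xs = l @ [x]"
proof -
  obtain l l' where "xs = (l @ [x]) @ l'"
    using split_list[OF assms] by auto
  then have "rotate (length (l @ [x])) xs = (l' @ l) @ [x]"
    using rotate_append[of "l @ [x]" l'] by simp
  then show ?thesis by blast
qed

lemma obtain_map_Some:
  assumes "None \<notin> set xs"
  obtains us where "xs = map Some us"
proof
  show "xs = map Some (map the xs)"
    using assms by (induction xs) auto
qed

lemma path_binomial_eq:
  assumes "odd (length w)"
  shows "path_binomial w =
    Poly_Mapping.single (Poly_Mapping.single (Vert (hd w)) 1 + walk_monomial (tl (evens w)) (odds w)) (1::'k::field) -
    Poly_Mapping.single (Poly_Mapping.single (Vert (last w)) 1 + walk_monomial (evens w) (odds w)) 1"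
  by (simp add: path_binomial_def vert_def Var_def T_plus_eq T_minus_eq mult_single)

context bipartite
begin

lemma arcs_simps [simp]:
  "(Some x, Some y) \<in> A \<longleftrightarrow> x \<in> X \<and> y \<in> Y \<and> {x, y} \<in> E"
  "(Some x, None) \<in> A \<longleftrightarrow> x \<in> X"
  "(None, Some y) \<in> A \<longleftrightarrow> y \<in> Y"
  "(None, None) \<notin> A"
  by (auto simp: arcs_def)

lemma edge_sides:
  assumes "{u, v} \<in> E"
  shows "u \<in> X \<Longrightarrow> v \<in> Y" "u \<in> Y \<Longrightarrow> v \<in> X" "u \<in> X \<union> Y"
proof -
  obtain x y where xy: "{u, v} = {x, y}" "x \<in> X" "y \<in> Y"
    using assms E_sub by blast
  then have "u = x \<and> v = y \<or> u = y \<and> v = x"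
    by (simp add: doubleton_eq_iff)
  then show "u \<in> X \<Longrightarrow> v \<in> Y" "u \<in> Y \<Longrightarrow> v \<in> X" "u \<in> X \<union> Y"
    using xy disjoint by auto
qed

abbreviation "walk \<equiv> successively (\<lambda>u v. {u, v} \<in> E)"

lemma walk_sides:
  "walk w \<Longrightarrow> w \<noteq> [] \<Longrightarrow> hd w \<in> X \<Longrightarrow> set (evens w) \<subseteq> X \<and> set (odds w) \<subseteq> Y"
  "walk w \<Longrightarrow> w \<noteq> [] \<Longrightarrow> hd w \<in> Y \<Longrightarrow> set (evens w) \<subseteq> Y \<and> set (odds w) \<subseteq> X"
proof (induction w)
  case (Cons u w)
  {
    case 1
    then show ?case
      using Cons.IH(2) edge_sides[of u "hd w"] by (cases w) auto
  next
    case 2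
    then show ?case
      using Cons.IH(1) edge_sides[of u "hd w"] by (cases w) auto
  }
qed simp_all

lemma walk_iff_arcs:
  "w \<noteq> [] \<Longrightarrow> walk w \<and> hd w \<in> X \<longleftrightarrow> hd w \<in> X \<and>
     set (zip (map Some (evens w)) (map Some (odds w))) \<subseteq> A \<and>
     set (zip (tl (map Some (evens w))) (map Some (odds w))) \<subseteq> A"
  "w \<noteq> [] \<Longrightarrow> walk w \<and> hd w \<in> Y \<longleftrightarrow> hd w \<in> Y \<and>
     set (zip (map Some (odds w)) (map Some (evens w))) \<subseteq> A \<and>
     set (zip (map Some (odds w)) (tl (map Some (evens w)))) \<subseteq> A"
proof (induction w)
  case (Cons u w)
  {
    case 1
    show ?case
    proof (cases w)
      case (Cons v w')
      then show ?thesis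
        using Cons.IH(2) edge_sides[of u v] by (auto simp: insert_commute)
    qed simp
  next
    case 2
    show ?case
    proof (cases w)
      case (Cons v w')
      then show ?thesis
        using Cons.IH(1) edge_sides[of u v] by (auto simp: insert_commute)
    qed simp
  }
qed simp_all

lemma is_path_hd: "is_path E w \<Longrightarrow> hd w \<in> X \<union> Y"
  using edge_sides(3)
  by (cases w; cases "tl w") (auto simp: is_path_def walk_length_def neq_Nil_conv)

text \<open>A path between two vertices of \<open>X\<close> is closed by the additional vertex on the side of \<open>Y\<close>; the two
  edges at this vertex are the variables of the ends of the path.\<close>

lemma alt_cycle_even_path_X:
  assumes "odd (length w)"
  shows "alt_cycle A (map Some (evens w)) (map Some (odds w) @ [None]) \<longleftrightarrow> even_path E w \<and> hd w \<in> X"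
    (is "alt_cycle A ?us (?vs @ [None]) \<longleftrightarrow> _")
  and "path_binomial w =
    - (circuit_binomial (map Some (evens w)) (map Some (odds w) @ [None]) :: ('v rees_var, 'k::field) mpoly)"
proof -
  have len: "length ?us = Suc (length ?vs)" and w: "w \<noteq> []"
    using assms by (auto simp: length_evens length_odds elim!: oddE)
  have ne: "?us \<noteq> []" using len by auto
  have last: "last ?us = Some (last w)" and hd: "hd ?us = Some (hd w)"
    using ne w assms by (simp_all add: last_map hd_map last_evens hd_evens)
  have rot: "zip (rotate1 ?us) (?vs @ [None]) = zip (tl ?us) ?vs @ [(hd ?us, None)]"
    using len ne by (cases ?us) auto
  show "path_binomial w = - (circuit_binomial ?us (?vs @ [None]) :: ('v rees_var, 'k) mpoly)"
    unfolding circuit_binomial_def zip_snoc_right[OF len] rot path_binomial_eq[OF assms] last hd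
    by (simp add: arc_product_zip_Some add.commute flip: map_tl)
  from rot have "alt_cycle A ?us (?vs @ [None]) \<longleftrightarrow> 3 \<le> length w \<and> distinct (evens w) \<and> distinct (odds w) \<and>
      set (zip ?us ?vs) \<subseteq> A \<and> last w \<in> X \<and> set (zip (tl ?us) ?vs) \<subseteq> A \<and> hd w \<in> X"
    unfolding alt_cycle_def zip_snoc_right[OF len] last hd using len assms
    by (auto simp: distinct_map length_evens elim!: oddE)
  also have "\<dots> \<longleftrightarrow> 3 \<le> length w \<and> distinct (evens w) \<and> distinct (odds w) \<and> last w \<in> X \<and> walk w \<and> hd w \<in> X"
    using walk_iff_arcs(1)[OF w] by blast
  also have "\<dots> \<longleftrightarrow> 3 \<le> length w \<and> distinct w \<and> walk w \<and> hd w \<in> X"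
    using walk_sides(1)[of w] w disjoint last_evens[OF assms] last_in_set[of "evens w"] ne
    unfolding distinct_evens_odds[of w] by auto
  also have "\<dots> \<longleftrightarrow> even_path E w \<and> hd w \<in> X"
    using assms by (auto simp: even_path_def is_path_def walk_length_def elim!: oddE)
  finally show "alt_cycle A ?us (?vs @ [None]) \<longleftrightarrow> even_path E w \<and> hd w \<in> X" .
qed

text \<open>Here the closing vertex lies on the side of \<open>X\<close>. The path starts on the right, so the roles
  of the two lists, and with them the sign of the binomial, are exchanged.\<close>

lemma alt_cycle_even_path_Y:
  assumes "odd (length w)"
  shows "alt_cycle A (None # map Some (odds w)) (map Some (evens w)) \<longleftrightarrow> even_path E w \<and> hd w \<in> Y"
    (is "alt_cycle A (None # ?vs) ?us \<longleftrightarrow> _")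
  and "path_binomial w =
    (circuit_binomial (None # map Some (odds w)) (map Some (evens w)) :: ('v rees_var, 'k::field) mpoly)"
proof -
  have len: "length ?us = Suc (length ?vs)" and w: "w \<noteq> []"
    using assms by (auto simp: length_evens length_odds elim!: oddE)
  have ne: "?us \<noteq> []" using len by auto
  have last: "last ?us = Some (last w)" and hd: "hd ?us = Some (hd w)"
    using ne w assms by (simp_all add: last_map hd_map last_evens hd_evens)
  have zip: "zip (None # ?vs) ?us = (None, hd ?us) # zip ?vs (tl ?us)"
    using ne by (cases ?us) auto
  show "path_binomial w = (circuit_binomial (None # ?vs) ?us :: ('v rees_var, 'k) mpoly)"
    unfolding circuit_binomial_def rotate1.simps zip_snoc_left[OF len] zip path_binomial_eq[OF assms] last hd
    by (simp add: arc_product_zip_Some add.commute walk_monomial_commute[of "odds w"] flip: map_tl)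
  from zip have "alt_cycle A (None # ?vs) ?us \<longleftrightarrow> 3 \<le> length w \<and> distinct (evens w) \<and> distinct (odds w) \<and>
      set (zip ?vs ?us) \<subseteq> A \<and> last w \<in> Y \<and> set (zip ?vs (tl ?us)) \<subseteq> A \<and> hd w \<in> Y"
    unfolding alt_cycle_def rotate1.simps zip_snoc_left[OF len] last hd using len assms
    by (auto simp: distinct_map length_odds elim!: oddE)
  also have "\<dots> \<longleftrightarrow> 3 \<le> length w \<and> distinct (evens w) \<and> distinct (odds w) \<and> last w \<in> Y \<and> walk w \<and> hd w \<in> Y"
    using walk_iff_arcs(2)[OF w] by blast
  also have "\<dots> \<longleftrightarrow> 3 \<le> length w \<and> distinct w \<and> walk w \<and> hd w \<in> Y"
    using walk_sides(2)[of w] w disjoint last_evens[OF assms] last_in_set[of "evens w"] ne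
    unfolding distinct_evens_odds[of w] by auto
  also have "\<dots> \<longleftrightarrow> even_path E w \<and> hd w \<in> Y"
    using assms by (auto simp: even_path_def is_path_def walk_length_def elim!: oddE)
  finally show "alt_cycle A (None # ?vs) ?us \<longleftrightarrow> even_path E w \<and> hd w \<in> Y" .
qed

text \<open>A closed walk contains its first vertex twice, at both ends of \<open>evens w\<close>; without the repetition
  the shift by one edge becomes a rotation. If the walk starts in \<open>Y\<close>, the cycle is entered one vertex
  later, which rotates one of the two lists.\<close>

lemma alt_cycle_even_cycle:
  assumes w: "evens w = us @ [hd us]" "odds w = vs" and len: "length us = length vs" and ne: "us \<noteq> []"
  shows "alt_cycle A (map Some us) (map Some vs) \<longleftrightarrow> even_cycle E w \<and> hd w \<in> X"
    and "cycle_binomial w = - (circuit_binomial (map Some us) (map Some vs) :: ('v rees_var, 'k::field) mpoly)"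
    and "even_cycle E w \<Longrightarrow> hd w \<in> Y \<Longrightarrow> alt_cycle A (map Some vs) (map Some (rotate1 us))"
    and "cycle_binomial w = (circuit_binomial (map Some vs) (map Some (rotate1 us)) :: ('v rees_var, 'k::field) mpoly)"
proof -
  obtain a w' where aw: "w = a # w'"
    using w(1) by (cases w) auto
  have lw: "length w = Suc (2 * length us)"
    using length_evens[of w] length_odds[of w] w len by simp
  have hd: "hd w = hd us" and last: "last w = hd us"
    using w aw hd_evens[of w] last_evens[of w] lw ne by simp_all
  have tl: "evens (tl w) = vs" "odds (tl w) = rotate1 us"
    using w aw ne by (cases us; simp)+
  have rot: "tl (evens w) = rotate1 us"
    using w(1) ne by (cases us) auto
  have trunc: "zip (map Some (us @ [hd us])) (map Some vs) = zip (map Some us) (map Some vs)"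
      "zip (map Some vs) (map Some (us @ [hd us])) = zip (map Some vs) (map Some us)"
    using len by (simp_all add: zip_append1 zip_append2)
  have cycle: "even_cycle E w \<longleftrightarrow> 2 \<le> length us \<and> walk w \<and> distinct us \<and> distinct vs \<and> set us \<inter> set vs = {}"
    unfolding even_cycle_def is_cycle_def walk_length_def distinct_evens_odds[of "tl w"] tl
    using lw hd last by auto
  have sides: "hd w \<in> X \<Longrightarrow> walk w \<Longrightarrow> set us \<inter> set vs = {}"
  proof -
    assume "hd w \<in> X" "walk w"
    moreover have "w \<noteq> []" using aw by simp
    ultimately have "set (evens w) \<subseteq> X \<and> set (odds w) \<subseteq> Y"
      using walk_sides(1) by blast
    then show "set us \<inter> set vs = {}"
      using disjoint unfolding w by auto
  qed
  have rot': "tl (map Some (evens w)) = rotate1 (map Some us)"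
    using rot by (simp add: rotate1_map flip: map_tl)
  have "w \<noteq> []" using aw by simp
  note arcs = walk_iff_arcs[OF this, unfolded rot', unfolded w trunc]
  have hdX: "hd w \<in> X" if "set (zip (map Some us) (map Some vs)) \<subseteq> A"
    using that len ne hd by (cases us; cases vs) auto
  show "alt_cycle A (map Some us) (map Some vs) \<longleftrightarrow> even_cycle E w \<and> hd w \<in> X"
    unfolding cycle alt_cycle_def using arcs sides hdX len by (simp add: distinct_map) blast
  have plus: "T_plus w = (Poly_Mapping.single (walk_monomial (rotate1 us) vs) 1 :: ('v rees_var, 'k) mpoly)"
    using T_plus_eq[of w, where 'k = 'k] w rot by simp
  have "walk_monomial (us @ [hd us]) vs = walk_monomial us vs"
    using len by (simp add: walk_monomial_def zip_append1)
  then have minus: "T_minus w = (Poly_Mapping.single (walk_monomial us vs) 1 :: ('v rees_var, 'k) mpoly)"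
    using T_minus_eq[of w, where 'k = 'k] w by simp
  show "cycle_binomial w = - (circuit_binomial (map Some us) (map Some vs) :: ('v rees_var, 'k) mpoly)"
    unfolding cycle_binomial_def circuit_binomial_def plus minus
    by (simp add: rotate1_map arc_product_zip_Some)
  have zz: "zip (rotate1 (map Some vs)) (rotate1 (map Some us)) = rotate1 (zip (map Some vs) (map Some us))"
    using len by (simp add: rotate1_zip)
  show "cycle_binomial w = (circuit_binomial (map Some vs) (map Some (rotate1 us)) :: ('v rees_var, 'k) mpoly)"
    unfolding cycle_binomial_def circuit_binomial_def plus minus rotate1_map[symmetric] zz
    using arc_product_rotate[of 1 "zip (map Some vs) (map Some us)"]
    by (simp add: rotate1_map arc_product_zip_Some walk_monomial_commute[of vs])
  assume "even_cycle E w" "hd w \<in> Y"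
  then show "alt_cycle A (map Some vs) (map Some (rotate1 us))"
    unfolding cycle alt_cycle_def rotate1_map[symmetric] zz using arcs(2) len
    by (simp add: distinct_map)
qed

text \<open>The path \<open>w1\<close> leads from the first additional vertex to the second one, and \<open>w2\<close> leads back.\<close>

lemma alt_cycle_odd_paths:
  assumes ev: "even (length w1)" "even (length w2)" and ne: "w1 \<noteq> []" "w2 \<noteq> []"
  defines "xs \<equiv> None # map Some (odds w1) @ map Some (evens w2)"
    and "ys \<equiv> map Some (evens w1) @ None # map Some (odds w2)"
  shows "alt_cycle A xs ys \<longleftrightarrow>
      odd_path E w1 \<and> odd_path E w2 \<and> disjoint_paths w1 w2 \<and> hd w1 \<in> Y \<and> hd w2 \<in> X"
    and "path_pair_binomial w1 w2 = (circuit_binomial xs ys :: ('v rees_var, 'k::field) mpoly)"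
proof -
  let ?u1 = "map Some (evens w1)" and ?v1 = "map Some (odds w1)"
    and ?u2 = "map Some (evens w2)" and ?v2 = "map Some (odds w2)"
  have len: "length ?u1 = length ?v1" "length ?u2 = length ?v2"
    using ev by (auto simp: length_evens length_odds)
  have ne': "?u1 \<noteq> []" "?u2 \<noteq> []" "?v1 \<noteq> []" "?v2 \<noteq> []"
    using ne len by (cases w1; cases w2; auto)+
  have ends: "hd ?u1 = Some (hd w1)" "last ?v1 = Some (last w1)" "hd ?u2 = Some (hd w2)" "last ?v2 = Some (last w2)"
    using ne' ne ev by (simp_all add: hd_map last_map hd_evens last_odds)
  have "zip xs ys = (None, hd ?u1) # zip (?v1 @ ?u2) ((tl ?u1 @ [None]) @ ?v2)"
    unfolding xs_def ys_def using ne' by (cases ?u1) auto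
  also have "zip (?v1 @ ?u2) ((tl ?u1 @ [None]) @ ?v2) = zip ?v1 (tl ?u1 @ [None]) @ zip ?u2 ?v2"
    using len ne' by (intro zip_append) (cases ?u1, auto)
  also have "zip ?v1 (tl ?u1 @ [None]) = zip ?v1 (tl ?u1) @ [(last ?v1, None)]"
    using len ne' by (intro zip_snoc_right) (cases ?u1, auto)
  finally have z1: "zip xs ys = (None, Some (hd w1)) # zip ?v1 (tl ?u1) @ (Some (last w1), None) # zip ?u2 ?v2"
    by (simp add: ends)
  have "zip (rotate1 xs) ys = zip (?v1 @ ?u2 @ [None]) (?u1 @ None # ?v2)"
    unfolding xs_def ys_def by simp
  also have "\<dots> = zip ?v1 ?u1 @ zip (?u2 @ [None]) (None # ?v2)"
    using len by (intro zip_append) simp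
  also have "zip (?u2 @ [None]) (None # ?v2) = (hd ?u2, None) # zip (tl ?u2 @ [None]) ?v2"
    using ne' by (cases ?u2) auto
  also have "zip (tl ?u2 @ [None]) ?v2 = zip (tl ?u2) ?v2 @ [(None, last ?v2)]"
    using len ne' by (intro zip_snoc_left) (cases ?u2, auto)
  finally have z2: "zip (rotate1 xs) ys =
      zip ?v1 ?u1 @ (Some (hd w2), None) # zip (tl ?u2) ?v2 @ [(None, Some (last w2))]"
    by (simp add: ends)
  show "path_pair_binomial w1 w2 = (circuit_binomial xs ys :: ('v rees_var, 'k) mpoly)"
    unfolding circuit_binomial_def z1 z2 path_pair_binomial_def T_pair_plus_def T_pair_minus_def
    by (simp add: T_plus_eq T_minus_eq vert_def Var_def mult_single arc_product_zip_Some
        walk_monomial_commute[of "odds w1"] ac_simps flip: map_tl)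
  let ?D = "distinct (evens w1) \<and> distinct (odds w1) \<and> distinct (evens w2) \<and> distinct (odds w2) \<and>
      set (odds w1) \<inter> set (evens w2) = {} \<and> set (evens w1) \<inter> set (odds w2) = {}"
  have len_xy: "length xs = length ys" "2 \<le> length xs"
    using len ne' unfolding xs_def ys_def by (auto simp: Suc_le_eq)
  have dist: "distinct xs \<and> distinct ys \<longleftrightarrow> ?D"
    unfolding xs_def ys_def by (auto simp: distinct_map)
  have "alt_cycle A xs ys \<longleftrightarrow> ?D \<and> walk w1 \<and> hd w1 \<in> Y \<and> last w1 \<in> X \<and> walk w2 \<and> hd w2 \<in> X \<and> last w2 \<in> Y"
    unfolding alt_cycle_def z1 z2 using len_xy dist walk_iff_arcs(2)[OF ne(1)] walk_iff_arcs(1)[OF ne(2)]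
    by (simp only: set_simps set_append Un_subset_iff insert_subset arcs_simps) blast
  also have "\<dots> \<longleftrightarrow> odd_path E w1 \<and> odd_path E w2 \<and> disjoint_paths w1 w2 \<and> hd w1 \<in> Y \<and> hd w2 \<in> X" (is "?l \<longleftrightarrow> ?r")
  proof -
    have "2 \<le> length w1" "2 \<le> length w2"
      using ev ne by (cases w1; cases "tl w1"; cases w2; cases "tl w2"; auto)+
    then have wl: "1 \<le> walk_length w1" "1 \<le> walk_length w2" "odd (walk_length w1)" "odd (walk_length w2)"
      using ev by (auto simp: walk_length_def)
    have paths: "odd_path E w1 \<longleftrightarrow> walk w1 \<and> distinct w1" "odd_path E w2 \<longleftrightarrow> walk w2 \<and> distinct w2"
      using wl by (simp_all add: odd_path_def is_path_def)
    show ?thesis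
    proof (cases "walk w1 \<and> hd w1 \<in> Y \<and> walk w2 \<and> hd w2 \<in> X")
      case True
      then have s: "set (evens w1) \<subseteq> Y" "set (odds w1) \<subseteq> X" "set (evens w2) \<subseteq> X" "set (odds w2) \<subseteq> Y"
        using walk_sides ne by blast+
      have l: "last w1 \<in> X" "last w2 \<in> Y"
        using s ne' last_odds[OF ne(1) ev(1)] last_odds[OF ne(2) ev(2)]
          last_in_set[of "odds w1"] last_in_set[of "odds w2"] by auto
      show ?thesis
        using True s l disjoint unfolding paths distinct_evens_odds[of w1] distinct_evens_odds[of w2]
          disjoint_paths_def set_evens_odds[of w1] set_evens_odds[of w2] by blast
    qed (auto simp: paths)
  qed
  finally show "alt_cycle A xs ys \<longleftrightarrow>
      odd_path E w1 \<and> odd_path E w2 \<and> disjoint_paths w1 w2 \<and> hd w1 \<in> Y \<and> hd w2 \<in> X" .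
qed

end

text \<open>Reversing a walk with an odd number of edges preserves the parity of the position of each edge.\<close>

lemma T_rev:
  assumes "odd (walk_length w)"
  shows "T_plus (rev w) = T_plus w" "T_minus (rev w) = T_minus w"
proof -
  let ?n = "walk_length w"
  have len: "length w = Suc ?n" "walk_length (rev w) = ?n"
    using assms by (cases w; simp add: walk_length_def)+
  have step: "Edge {rev w ! (j - Suc 0), rev w ! j} = Edge {w ! (?n - j), w ! (Suc ?n - j)}"
    if "1 \<le> j" "j \<le> ?n" for j
    using that by (simp add: rev_nth len insert_commute Suc_diff_le)
  show "T_plus (rev w) = T_plus w"
    unfolding T_plus_def len(2)
    by (rule prod.reindex_bij_witness[of _ "\<lambda>j. Suc ?n - j" "\<lambda>j. Suc ?n - j"])
      (use assms in \<open>auto simp: step\<close>)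
  show "T_minus (rev w) = T_minus w"
    unfolding T_minus_def len(2)
    by (rule prod.reindex_bij_witness[of _ "\<lambda>j. Suc ?n - j" "\<lambda>j. Suc ?n - j"])
      (use assms in \<open>auto simp: step\<close>)
qed

context bipartite
begin

lemma odd_path_rev:
  assumes "odd_path E w"
  shows "odd_path E (rev w)" "hd w \<in> X \<Longrightarrow> hd (rev w) \<in> Y" "hd w \<in> Y \<Longrightarrow> hd (rev w) \<in> X"
    "w \<noteq> []" "even (length w)"
proof -
  show ne: "w \<noteq> []" and ev: "even (length w)"
    using assms by (cases w; auto simp: odd_path_def is_path_def walk_length_def)+
  show "odd_path E (rev w)"
    using assms by (simp add: odd_path_def is_path_def walk_length_def successively_rev insert_commute)
  have "walk w" and "odds w \<noteq> []"
    using assms length_odds[of w] ev ne by (auto simp: odd_path_def is_path_def elim!: evenE)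
  then show "hd w \<in> X \<Longrightarrow> hd (rev w) \<in> Y" "hd w \<in> Y \<Longrightarrow> hd (rev w) \<in> X"
    using walk_sides[of w] ne last_odds[OF ne ev] last_in_set[of "odds w"] by (auto simp: hd_rev)
qed

lemma path_pair_binomial_rev:
  "odd_path E w1 \<Longrightarrow> path_pair_binomial (rev w1) w2 = path_pair_binomial w1 w2"
  "odd_path E w2 \<Longrightarrow> path_pair_binomial w1 (rev w2) = path_pair_binomial w1 w2"
  by (simp_all add: path_pair_binomial_def T_pair_plus_def T_pair_minus_def T_rev odd_path_def
      hd_rev last_rev mult.commute)

text \<open>Rotation moves an additional vertex to an end of its list, where it can be cut off; a second one
  splits the rest into two paths. The sign of the binomial is adjusted by reversing the cycle.\<close>

lemma circuit_binomials_eq: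
  "{circuit_binomial xs ys :: ('v rees_var, 'k::field) mpoly | xs ys. alt_cycle A xs ys} =
     {cycle_binomial w | w. even_cycle E w} \<union> {path_binomial w | w. even_path E w}
     \<union> {path_pair_binomial w1 w2 | w1 w2. odd_path E w1 \<and> odd_path E w2 \<and> disjoint_paths w1 w2}"
    (is "?C = ?R")
proof
  have pos: "circuit_binomial xs ys \<in> ?C" if "alt_cycle A xs ys" for xs ys
    using that by blast
  have neg: "- circuit_binomial xs ys \<in> ?C" if "alt_cycle A xs ys" for xs ys
    using pos[OF alt_cycle_reverse(1)[OF that]] circuit_binomial_reverse[OF that, where 'b = 'k] by simp
  show "?R \<subseteq> ?C"
  proof
    fix g :: "('v rees_var, 'k) mpoly" assume "g \<in> ?R"
    then consider w where "g = cycle_binomial w" "even_cycle E w"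
      | w where "g = path_binomial w" "even_path E w"
      | w1 w2 where "g = path_pair_binomial w1 w2" "odd_path E w1" "odd_path E w2" "disjoint_paths w1 w2"
      by blast
    then show "g \<in> ?C"
    proof cases
      case (1 w)
      let ?us = "butlast (evens w)"
      have lw: "4 \<le> walk_length w" "even (walk_length w)" and hl: "hd w = last w" and wk: "walk w"
        using 1(2) by (auto simp: even_cycle_def is_cycle_def elim!: evenE)
      then have ol: "odd (length w)" and len: "length (evens w) = Suc (length (odds w))" "2 \<le> length ?us"
        and ne: "w \<noteq> []"
        by (auto simp: length_evens length_odds walk_length_def elim!: evenE)
      have "evens w \<noteq> []" using len by auto
      moreover have "hd ?us = hd w"
        using len hd_evens[OF ne] by (cases "evens w") auto
      ultimately have us: "evens w = ?us @ [hd ?us]"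
        using last_evens[OF ol] hl append_butlast_last_id[of "evens w"] by simp
      have len': "length ?us = length (odds w)"
        using len by auto
      have ne': "?us \<noteq> []"
        using len(2) by (metis list.size(3) not_numeral_le_zero)
      note c = alt_cycle_even_cycle[OF us refl len' ne']
      have "hd w \<in> X \<union> Y"
        using wk lw edge_sides(3) by (cases w; cases "tl w") (auto simp: walk_length_def neq_Nil_conv)
      then show ?thesis
      proof
        assume "hd w \<in> X"
        then show ?thesis
          unfolding 1(1) c(2) using c(1) 1(2) neg by blast
      next
        assume "hd w \<in> Y"
        then show ?thesis
          unfolding 1(1) c(4) using c(3) 1(2) pos by blast
      qed
    next
      case (2 w)
      then have sides: "hd w \<in> X \<union> Y" and len: "odd (length w)"
        using is_path_hd by (auto simp: even_path_def is_path_def walk_length_def elim!: evenE)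
      from sides show ?thesis
      proof
        assume "hd w \<in> X"
        then show ?thesis
          unfolding 2(1) alt_cycle_even_path_X(2)[OF len]
          using alt_cycle_even_path_X(1)[OF len] 2(2) neg by blast
      next
        assume "hd w \<in> Y"
        then show ?thesis
          unfolding 2(1) alt_cycle_even_path_Y(2)[OF len]
          using alt_cycle_even_path_Y(1)[OF len] 2(2) pos by blast
      qed
    next
      case (3 w1 w2)
      define w1' where "w1' = (if hd w1 \<in> Y then w1 else rev w1)"
      define w2' where "w2' = (if hd w2 \<in> X then w2 else rev w2)"
      have "hd w1 \<in> X \<union> Y" "hd w2 \<in> X \<union> Y"
        using 3 is_path_hd by (auto simp: odd_path_def)
      then have w': "odd_path E w1'" "odd_path E w2'" "hd w1' \<in> Y" "hd w2' \<in> X"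
          "set w1' = set w1" "set w2' = set w2"
        using 3 odd_path_rev by (auto simp: w1'_def w2'_def)
      moreover have "g = path_pair_binomial w1' w2'"
        using 3 odd_path_rev by (auto simp: w1'_def w2'_def path_pair_binomial_rev)
      moreover have "disjoint_paths w1' w2'"
        using 3(4) w' by (simp add: disjoint_paths_def)
      ultimately show ?thesis
        using alt_cycle_odd_paths[of w1' w2'] odd_path_rev(4,5)[OF w'(1)] odd_path_rev(4,5)[OF w'(2)] by blast
    qed
  qed
  show "?C \<subseteq> ?R"
  proof
    fix g :: "('v rees_var, 'k) mpoly" assume "g \<in> ?C"
    then obtain xs ys where g: "g = circuit_binomial xs ys" and cyc: "alt_cycle A xs ys"
      by blast
    define xs' where "xs' = rev (rotate1 xs)"
    define ys' where "ys' = rev ys"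
    have rev: "g = - circuit_binomial xs' ys'" "alt_cycle A xs' ys'"
        "set xs' = set xs" "set ys' = set ys"
      using circuit_binomial_reverse[OF cyc, where 'b = 'k] alt_cycle_reverse(1)[OF cyc]
      by (simp_all add: xs'_def ys'_def g)
    show "g \<in> ?R"
    proof (cases "None \<in> set xs")
      case False
      show ?thesis
      proof (cases "None \<in> set ys")
        case no: False
        obtain us where us: "xs' = map Some us" using False rev(3) obtain_map_Some by blast
        obtain vs where vs: "ys' = map Some vs" using no rev(4) obtain_map_Some by blast
        have len: "length us = length vs" "us \<noteq> []"
          using rev(2) us vs by (auto simp: alt_cycle_def)
        obtain w where w: "evens w = us @ [hd us]" "odds w = vs"
          using evens_odds_surj[of "us @ [hd us]" vs] len by auto
        have "even_cycle E w" "g = cycle_binomial w"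
          using alt_cycle_even_cycle(1)[OF w len] alt_cycle_even_cycle(2)[OF w len, where 'k = 'k] rev us vs by simp_all
        then show ?thesis by blast
      next
        case True
        then obtain n l where n: "rotate n ys' = l @ [None]"
          using rotate_to_last rev(4) by metis
        have cyc': "alt_cycle A (rotate n xs') (rotate n ys')"
          and g': "g = - circuit_binomial (rotate n xs') (rotate n ys')"
          using alt_cycle_rotate[OF rev(2)] circuit_binomial_rotate[OF rev(2), where 'b = 'k] rev(1) by simp_all
        have "None \<notin> set l"
          using cyc' n by (auto simp: alt_cycle_def)
        then obtain vs where vs: "l = map Some vs" using obtain_map_Some by blast
        obtain us where us: "rotate n xs' = map Some us"
          using False rev(3) obtain_map_Some[of "rotate n xs'"] by auto
        have len: "length us = Suc (length vs)"
          using cyc' unfolding us n vs by (simp add: alt_cycle_def)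
        obtain w where w: "evens w = us" "odds w = vs" "length w = length us + length vs"
          using evens_odds_surj[of us vs] len by auto
        have "even_path E w" "g = path_binomial w"
          using alt_cycle_even_path_X(1)[of w] alt_cycle_even_path_X(2)[of w, where 'k = 'k] cyc' g' len w us n vs by simp_all
        then show ?thesis by blast
      qed
    next
      case True
      then obtain n r where n: "rotate n xs = None # r"
        using rotate_to_first by metis
      have cyc': "alt_cycle A (None # r) (rotate n ys)"
        and g': "g = circuit_binomial (None # r) (rotate n ys)"
        using alt_cycle_rotate[OF cyc] circuit_binomial_rotate[OF cyc, where 'b = 'k] g unfolding n[symmetric] by simp_all
      have "None \<notin> set r"
        using cyc' by (auto simp: alt_cycle_def)
      then obtain vs where vs: "r = map Some vs" using obtain_map_Some by blast
      show ?thesis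
      proof (cases "None \<in> set ys")
        case False
        then obtain us where us: "rotate n ys = map Some us"
          using obtain_map_Some[of "rotate n ys"] by auto
        have len: "length us = Suc (length vs)"
          using cyc' unfolding us vs by (simp add: alt_cycle_def)
        obtain w where w: "evens w = us" "odds w = vs" "length w = length us + length vs"
          using evens_odds_surj[of us vs] len by auto
        have "even_path E w" "g = path_binomial w"
          using alt_cycle_even_path_Y(1)[of w] alt_cycle_even_path_Y(2)[of w, where 'k = 'k] cyc' g' len w us vs by simp_all
        then show ?thesis by blast
      next
        case True
        then obtain l1 l2 where l: "rotate n ys = l1 @ None # l2"
          using split_list[of None "rotate n ys"] by auto
        have "None \<notin> set l1" "None \<notin> set l2"
          using cyc' unfolding l by (auto simp: alt_cycle_def)
        then obtain us1 vs2 where l12: "l1 = map Some us1" "l2 = map Some vs2"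
          using obtain_map_Some by metis
        have lenvs: "length vs = length us1 + length vs2"
          using cyc' unfolding l vs l12 by (simp add: alt_cycle_def)
        define vs1 where "vs1 = take (length us1) vs"
        define us2 where "us2 = drop (length us1) vs"
        have vs12: "vs = vs1 @ us2" and len: "length us1 = length vs1" "length us2 = length vs2"
          using lenvs by (simp_all add: vs1_def us2_def)
        note cyc'' = cyc'[unfolded l l12 vs vs12 map_append]
        \<comment> \<open>The two additional vertices are not adjacent, so that neither path is empty.\<close>
        have "us1 \<noteq> []"
          using cyc'' by (auto simp: alt_cycle_def)
        moreover have "vs2 \<noteq> []"
        proof
          assume "vs2 = []"
          then have "(None, None) \<in> set (zip (rotate1 (None # map Some vs1 @ map Some us2)) (map Some us1 @ None # map Some vs2))"
            using len by simp
          then show False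
            using cyc'' arcs_simps(4) unfolding alt_cycle_def by blast
        qed
        ultimately have ne: "us1 @ vs1 \<noteq> []" "us2 @ vs2 \<noteq> []"
          by simp_all
        obtain w1 where w1: "evens w1 = us1" "odds w1 = vs1" "length w1 = length us1 + length vs1"
          using evens_odds_surj[of us1 vs1] len by auto
        obtain w2 where w2: "evens w2 = us2" "odds w2 = vs2" "length w2 = length us2 + length vs2"
          using evens_odds_surj[of us2 vs2] len by auto
        have w: "even (length w1)" "even (length w2)" "w1 \<noteq> []" "w2 \<noteq> []"
          using w1 w2 len ne by auto
        have "odd_path E w1 \<and> odd_path E w2 \<and> disjoint_paths w1 w2"
          using alt_cycle_odd_paths(1)[OF w] cyc'' unfolding w1 w2 by simp
        moreover have "g = path_pair_binomial w1 w2"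
          using alt_cycle_odd_paths(2)[OF w, where 'k = 'k] g' unfolding w1 w2 l l12 vs vs12 map_append by simp
        ultimately show ?thesis by blast
      qed
    qed
  qed
qed

end


section \<open>The universal Groebner basis of the Rees ideal\<close>

theorem theorem1p1:
  fixes X Y :: "'v set" and E :: "'v set set"
  assumes "bipartite_graph X Y E"
  shows "universal_groebner_basis (rees_vars X Y E)
           (defining_ideal X Y E :: ('v rees_var, 'k::field) mpoly set) =
         {cycle_binomial w | w. even_cycle E w}
         \<union> {path_binomial w | w. even_path E w}
         \<union> {path_pair_binomial w1 w2 | w1 w2.
              odd_path E w1 \<and> odd_path E w2 \<and> disjoint_paths w1 w2}"
proof -
  interpret bipartite X Y E by standard (rule assms)
  have "universal_groebner_basis V (defining_ideal X Y E :: ('v rees_var, 'k) mpoly set) =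
      {Poly_Mapping.single p 1 - Poly_Mapping.single q 1 | p q. (p, q) \<in> circuits}"
    by (rule toric_circuits.universal_groebner_basis_circuits[OF toric_circuits_defining_ideal])
  also have "\<dots> = {circuit_binomial xs ys | xs ys. alt_cycle A xs ys}"
    unfolding circuits_def circuit_binomial_def by blast
  finally show ?thesis
    unfolding circuit_binomials_eq .
qed

end
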